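(* For any arclength parametrized knot $\gamma\in W^{\frac32,2}(\mathbb{R}/\mathbb{Z},\mathbb{R}^3)$ there exists $\epsilon_\gamma>0$ such that every arclength parametrized curve $\eta\in W^{\frac32,2}(\mathbb{R}/\mathbb{Z},\mathbb{R}^3)$ with $\|\eta-\gamma\|_{W^{\frac32,2}}<\epsilon_\gamma$ is a knot equivalent to $\gamma$.
   Context: A knot is an injective continuous map $\mathbb{R}/\mathbb{Z}\to\mathbb{R}^3$. Two knots $\gamma_1,\gamma_2$ are equivalent if there is a homeomorphism $h:\mathbb{R}^3\to\mathbb{R}^3$ (not necessarily orientation preserving) mapping $\gamma_1(\mathbb{R}/\mathbb{Z})$ onto $\gamma_2(\mathbb{R}/\mathbb{Z})$. A curve is arclength parametrized if $|\gamma'|=1$ a.e. The fractional Sobolev space $W^{\frac32,2}(\mathbb{R}/\mathbb{Z},\mathbb{R}^3)$ consists of the $W^{1,2}$-maps $f$ with finite seminorm $\lfloor f'\rfloor_{\frac12,2}$, where $$\lfloor f'\rfloor_{\frac12,2}^2=\int_{\mathbb{R}/\mathbb{Z}}\int_{\mathbb{R}/\mathbb{Z}}\frac{|f'(u)-f'(v)|^2}{|u-v|_{\mathbb{R}/\mathbb{Z}}^2}\,du\,dv,$$ $|u-v|_{\mathbb{R}/\mathbb{Z}}$ is the periodic distance, and the norm is $\|f\|_{W^{\frac32,2}}=\|f\|_{W^{1,2}}+\lfloor f'\rfloor_{\frac12,2}$. *)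

theory Defs
  imports "HOL-Analysis.Analysis" "HOL-Library.Periodic_Fun"
begin

text \<open>
  Maps on \<open>\<real>/\<int>\<close> are represented by 1-periodic functions on \<^typ>\<open>real\<close>
  (\<^const>\<open>periodic_fun_simple'\<close>), and integrals over \<open>\<real>/\<int>\<close> by
  Lebesgue integrals over the unit interval.
\<close>

definition periodic_dist :: "real \<Rightarrow> real \<Rightarrow> real" where
  "periodic_dist u v = infdist (u - v) \<int>"

definition L2_periodic :: "(real \<Rightarrow> 'a::euclidean_space) \<Rightarrow> bool" where
  "L2_periodic f \<longleftrightarrow> periodic_fun_simple' f
     \<and> f \<in> borel_measurable (lebesgue_on {0..1})
     \<and> integrable (lebesgue_on {0..1}) (\<lambda>x. (norm (f x))\<^sup>2)"

definition smooth_periodic :: "(real \<Rightarrow> real) \<Rightarrow> bool" where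
  "smooth_periodic \<phi> \<longleftrightarrow> periodic_fun_simple' \<phi>
     \<and> (\<forall>n x. (deriv ^^ n) \<phi> field_differentiable at x)"

text \<open>The domain has no boundary, so the test functions need no support condition.\<close>

definition has_weak_deriv ::
    "(real \<Rightarrow> 'a::euclidean_space) \<Rightarrow> (real \<Rightarrow> 'a) \<Rightarrow> bool" where
  "has_weak_deriv f g \<longleftrightarrow> (\<forall>\<phi>. smooth_periodic \<phi> \<longrightarrow>
     (LINT x|lebesgue_on {0..1}. deriv \<phi> x *\<^sub>R f x) =
     - (LINT x|lebesgue_on {0..1}. \<phi> x *\<^sub>R g x))"

definition W12 :: "(real \<Rightarrow> 'a::euclidean_space) set" where
  "W12 = {f. L2_periodic f \<and> (\<exists>g. L2_periodic g \<and> has_weak_deriv f g)}"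

text \<open>
  An arbitrary representative of the weak derivative, meaningful for \<open>f \<in> W12\<close>.
  It is determined up to a null set, and everything below depends on it only up to null sets.
\<close>

definition weak_deriv :: "(real \<Rightarrow> 'a::euclidean_space) \<Rightarrow> real \<Rightarrow> 'a" where
  "weak_deriv f = (SOME g. L2_periodic g \<and> has_weak_deriv f g)"

definition W12_norm :: "(real \<Rightarrow> 'a::euclidean_space) \<Rightarrow> real" where
  "W12_norm f = sqrt ((LINT x|lebesgue_on {0..1}. (norm (f x))\<^sup>2)
                    + (LINT x|lebesgue_on {0..1}. (norm (weak_deriv f x))\<^sup>2))"

definition half_energy :: "(real \<Rightarrow> 'a::euclidean_space) \<Rightarrow> ennreal" where
  "half_energy g =
     (\<integral>\<^sup>+u. (\<integral>\<^sup>+v. ennreal ((norm (g u - g v))\<^sup>2 / (periodic_dist u v)\<^sup>2)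
        \<partial>lebesgue_on {0..1}) \<partial>lebesgue_on {0..1})"

definition W32 :: "(real \<Rightarrow> 'a::euclidean_space) set" where
  "W32 = {f \<in> W12. half_energy (weak_deriv f) < \<infinity>}"

definition W32_norm :: "(real \<Rightarrow> 'a::euclidean_space) \<Rightarrow> real" where
  "W32_norm f = W12_norm f + sqrt (enn2real (half_energy (weak_deriv f)))"

definition closed_curve :: "(real \<Rightarrow> real^3) \<Rightarrow> bool" where
  "closed_curve \<gamma> \<longleftrightarrow> periodic_fun_simple' \<gamma> \<and> continuous_on UNIV \<gamma>"

definition knot :: "(real \<Rightarrow> real^3) \<Rightarrow> bool" where
  "knot \<gamma> \<longleftrightarrow> closed_curve \<gamma> \<and> inj_on \<gamma> {0..<1}"

definition knot_equivalent :: "(real \<Rightarrow> real^3) \<Rightarrow> (real \<Rightarrow> real^3) \<Rightarrow> bool" where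
  "knot_equivalent \<gamma>\<^sub>1 \<gamma>\<^sub>2 \<longleftrightarrow>
     (\<exists>h k. homeomorphism UNIV UNIV h k \<and> h ` range \<gamma>\<^sub>1 = range \<gamma>\<^sub>2)"

text \<open>Only applied to curves in \<^const>\<open>W32\<close>.\<close>

definition arclength_parametrized :: "(real \<Rightarrow> real^3) \<Rightarrow> bool" where
  "arclength_parametrized \<gamma> \<longleftrightarrow> (AE u in lebesgue_on {0..1}. norm (weak_deriv \<gamma> u) = 1)"

end

theory Submission
  imports Defs
begin

text \<open>
  For arclength parametrized curves, smallness of the local energy
  \<open>\<integral>\<^sub>I \<integral>\<^sub>I |c'(u) - c'(v)|\<^sup>2 / |u - v|\<^sup>2\<close> says that \<open>c\<close> is almost straight at small scales:
  because \<open>|c'| = 1\<close>, an interval \<open>I\<close> of length \<open>r\<close> with endpoints \<open>a\<close> and \<open>b\<close> satisfies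
  \<open>2 (r\<^sup>2 - |c b - c a|\<^sup>2) = \<integral>\<^sub>I \<integral>\<^sub>I |c'(u) - c'(v)|\<^sup>2\<close>,
  which is at most \<open>r\<^sup>2\<close> times that energy. The energy of \<open>\<gamma>\<close> over short intervals is uniformly small by
  absolute continuity of the integral, and it controls the one of every \<open>\<eta>\<close> with
  \<open>\<eta> - \<gamma>\<close> small. So there is one scale \<open>\<rho>\<close> below which all chords of \<open>\<gamma>\<close> and of all such \<open>\<eta>\<close> have
  at least \<open>399/400\<close> of the length of their arcs (\<open>nearly_straight_of_small_energy\<close>).

  The derivatives of \<open>\<eta>\<close> and \<open>\<gamma>\<close> need not be uniformly close, and the curves need not be \<open>C\<^sup>1\<close>, so a
  direct \<open>C\<^sup>1\<close> perturbation argument fails. The curves are compared through their averages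
  \<open>c\<^sub>r(t) = 1/r \<integral>\<^sub>t\<^sup>t\<^sup>+\<^sup>r c\<close>, whose derivatives are the difference quotients \<open>(c(t + r) - c(t)) / r\<close>.
  Straightness makes \<open>c\<^sub>r\<close> bi-Lipschitz on short arcs with a constant that does not depend on \<open>r\<close>, and by the
  parallelogram law it makes the derivatives of \<open>c\<^sub>r\<close> and \<open>c\<^bsub>r/2\<^esub>\<close> uniformly close. Points farther apart
  than \<open>\<rho>\<close> along \<open>\<gamma>\<close> have separated images by compactness, and for them a small \<open>r\<close> is enough. Hence the displacement
  \<open>c\<^sub>r(t) \<mapsto> c\<^bsub>r/2\<^esub>(t) - c\<^sub>r(t)\<close> is a Lipschitz map with a small constant on the image of \<open>c\<^sub>r\<close>. It extends to
  \<open>\<real>\<^sup>3\<close>, and the identity plus a contraction is a homeomorphism. The composition of these homeomorphisms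
  for \<open>r, r/2, r/4, \<dots>\<close> converges together with its inverse, since the displacements decrease
  like \<open>2\<^sup>-\<^sup>n\<close> while the Lipschitz constants of the inverses grow only like \<open>(4/3)\<^sup>n\<close>. This yields a
  homeomorphism of \<open>\<real>\<^sup>3\<close> that carries \<open>c\<^sub>r\<close> to \<open>c\<close>. At a fixed scale \<open>r\<close> uniform
  closeness of \<open>\<eta>\<close> to \<open>\<gamma>\<close> is enough to carry \<open>\<eta>\<^sub>r\<close> to \<open>\<gamma>\<^sub>r\<close> in the same way, so the chain
  \<open>\<eta>, \<eta>\<^sub>r, \<gamma>\<^sub>r, \<gamma>\<close> gives the equivalence.

  What links the weak derivative to chords is \<open>weak_deriv_has_integral\<close>: a continuous function is
  the primitive of its weak derivative.
\<close>

section \<open>Homeomorphisms from small Lipschitz displacements\<close>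

text \<open>
  McShane's extension: the infimal convolution of the data with the cone \<open>L |x|\<close>. Clamping the
  result to \<open>[-M, M]\<close> costs nothing in the Lipschitz constant, and it keeps the displacement bound that the
  infinite composition needs.
\<close>

lemma lipschitz_extension_real:
  fixes f :: "'a::metric_space \<Rightarrow> real"
  assumes lip: "L-lipschitz_on S f" and bd: "\<And>x. x \<in> S \<Longrightarrow> \<bar>f x\<bar> \<le> M" and M: "0 \<le> M"
  shows "\<exists>g. L-lipschitz_on UNIV g \<and> (\<forall>x. \<bar>g x\<bar> \<le> M) \<and> (\<forall>x\<in>S. g x = f x)"
proof (cases "S = {}")
  case True
  have "L-lipschitz_on UNIV (\<lambda>x::'a. 0::real)"
    using lipschitz_on_nonneg[OF lip] by (intro lipschitz_onI) auto
  then show ?thesis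
    using True M by (intro exI[of _ "\<lambda>x. 0"]) auto
next
  case False
  have L: "0 \<le> L" using lipschitz_on_nonneg[OF lip] .
  define e where "e x = (INF s\<in>S. f s + L * dist x s)" for x
  have bb: "bdd_below ((\<lambda>s. f s + L * dist x s) ` S)" for x
  proof (rule bdd_belowI2)
    fix s assume "s \<in> S"
    then show "- M \<le> f s + L * dist x s"
      using bd[of s] mult_nonneg_nonneg[OF L zero_le_dist[of x s]] by linarith
  qed
  have e1: "e x \<le> e y + L * dist x y" for x y
  proof -
    have "e x - L * dist x y \<le> f s + L * dist y s" if "s \<in> S" for s
    proof -
      have "e x \<le> f s + L * dist x s"
        unfolding e_def by (rule cINF_lower[OF bb that])
      moreover have "L * dist x s \<le> L * (dist x y + dist y s)"
        using L by (intro mult_left_mono dist_triangle)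
      ultimately show ?thesis by (simp add: algebra_simps)
    qed
    then have "e x - L * dist x y \<le> e y"
      unfolding e_def[of y] by (intro cINF_greatest False)
    then show ?thesis by simp
  qed
  have e2: "e x = f x" if "x \<in> S" for x
  proof (rule antisym)
    show "e x \<le> f x"
      using cINF_lower[OF bb[of x] that] by (simp add: e_def)
    have "f x \<le> f s + L * dist x s" if "s \<in> S" for s
      using lipschitz_onD[OF lip \<open>x \<in> S\<close> that] by (simp add: dist_real_def)
    then show "f x \<le> e x"
      unfolding e_def by (intro cINF_greatest False)
  qed
  define g where "g x = max (- M) (min M (e x))" for x
  have "\<bar>e x - e y\<bar> \<le> L * dist x y" for x y
    using e1[of x y] e1[of y x] by (simp add: dist_commute)
  then have "\<bar>g x - g y\<bar> \<le> L * dist x y" for x y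
    unfolding g_def
    by (smt (verit, best))
  then have "L-lipschitz_on UNIV g"
    using L by (intro lipschitz_onI) (auto simp: dist_real_def)
  moreover have "\<bar>g x\<bar> \<le> M" for x
    using M by (auto simp: g_def)
  moreover have "g x = f x" if "x \<in> S" for x
    using bd[OF that] by (auto simp: g_def e2[OF that])
  ultimately show ?thesis by blast
qed

text \<open>
  Extending coordinate by coordinate loses a factor bounded by the dimension. Kirszbraun's theorem
  would avoid the loss, but a fixed factor is harmless for small constants.
\<close>

lemma lipschitz_extension_euclidean:
  fixes f :: "'a::metric_space \<Rightarrow> 'b::euclidean_space" and L M :: real
  assumes lip: "L-lipschitz_on S f" and bd: "\<And>x. x \<in> S \<Longrightarrow> norm (f x) \<le> M" and M: "0 \<le> M"
  shows "\<exists>g. (DIM('b) * L)-lipschitz_on UNIV g \<and> (\<forall>x. norm (g x) \<le> DIM('b) * M) \<and>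
    (\<forall>x\<in>S. g x = f x)"
proof -
  have L: "0 \<le> L" using lipschitz_on_nonneg[OF lip] .
  have "\<exists>g. L-lipschitz_on UNIV g \<and> (\<forall>x. \<bar>g x\<bar> \<le> M) \<and> (\<forall>x\<in>S. g x = f x \<bullet> b)"
    if b: "b \<in> Basis" for b
  proof -
    have lipb: "L-lipschitz_on S (\<lambda>x. f x \<bullet> b)"
    proof (rule lipschitz_onI[OF _ L])
      fix x y assume "x \<in> S" "y \<in> S"
      have "dist (f x \<bullet> b) (f y \<bullet> b) \<le> dist (f x) (f y)"
        using Basis_le_norm[OF b, of "f x - f y"]
        by (simp add: dist_norm inner_diff_left)
      also have "\<dots> \<le> L * dist x y"
        using \<open>x \<in> S\<close> \<open>y \<in> S\<close> by (rule lipschitz_onD[OF lip])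
      finally show "dist (f x \<bullet> b) (f y \<bullet> b) \<le> L * dist x y" .
    qed
    have bdb: "\<bar>f x \<bullet> b\<bar> \<le> M" if "x \<in> S" for x
      using Basis_le_norm[OF b, of "f x"] bd[OF that] by linarith
    show ?thesis by (rule lipschitz_extension_real[OF lipb bdb M])
  qed
  then have "\<forall>b\<in>Basis. \<exists>g. L-lipschitz_on UNIV g \<and> (\<forall>x. \<bar>g x\<bar> \<le> M) \<and> (\<forall>x\<in>S. g x = f x \<bullet> b)"
    by blast
  from bchoice[OF this] obtain G where "\<forall>b\<in>Basis. L-lipschitz_on UNIV (G b) \<and>
      (\<forall>x. \<bar>G b x\<bar> \<le> M) \<and> (\<forall>x\<in>S. G b x = f x \<bullet> b)" ..
  then have G: "\<And>b. b \<in> Basis \<Longrightarrow> L-lipschitz_on UNIV (G b)"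
      "\<And>b x. b \<in> Basis \<Longrightarrow> \<bar>G b x\<bar> \<le> M" "\<And>b x. b \<in> Basis \<Longrightarrow> x \<in> S \<Longrightarrow> G b x = f x \<bullet> b"
    by blast+
  define g where "g x = (\<Sum>b\<in>Basis. G b x *\<^sub>R b)" for x
  have gb: "g x \<bullet> b = G b x" if "b \<in> Basis" for x b
    using that by (simp add: g_def)
  have "dist (g x) (g y) \<le> DIM('b) * L * dist x y" for x y
  proof -
    have "norm (g x - g y) \<le> (\<Sum>b\<in>Basis. \<bar>(g x - g y) \<bullet> b\<bar>)"
      by (rule norm_le_l1)
    also have "\<dots> \<le> (\<Sum>b\<in>(Basis::'b set). L * dist x y)"
      using lipschitz_onD[OF G(1)]
      by (intro sum_mono) (auto simp: inner_diff_left gb dist_real_def)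
    finally show ?thesis by (simp add: dist_norm)
  qed
  then have 1: "(DIM('b) * L)-lipschitz_on UNIV g"
    using L by (intro lipschitz_onI) auto
  have 2: "norm (g x) \<le> DIM('b) * M" for x
  proof -
    have "norm (g x) \<le> (\<Sum>b\<in>Basis. \<bar>g x \<bullet> b\<bar>)"
      by (rule norm_le_l1)
    also have "\<dots> \<le> (\<Sum>b\<in>(Basis::'b set). M)"
      by (intro sum_mono) (auto simp: gb G(2))
    finally show ?thesis by simp
  qed
  have 3: "g x = f x" if "x \<in> S" for x
    using that by (subst euclidean_eq_iff) (auto simp: gb G(3))
  show ?thesis
    using 1 2 3 by (intro exI[of _ g] conjI allI ballI)
qed

text \<open>
  Surjectivity is Banach's fixed point theorem for \<open>x \<mapsto> y - g x\<close>. The map expands distances by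
  at least \<open>1 - L\<close>, which gives injectivity and the Lipschitz constant of the inverse.
\<close>

lemma homeomorphism_id_plus_contraction:
  fixes g :: "'a::banach \<Rightarrow> 'a"
  assumes lip: "L-lipschitz_on UNIV g" and L: "L < 1"
  obtains k where "homeomorphism UNIV UNIV (\<lambda>x. x + g x) k" "(1 / (1 - L))-lipschitz_on UNIV k"
proof -
  have L0: "0 \<le> L" using lipschitz_on_nonneg[OF lip] .
  let ?h = "\<lambda>x. x + g x"
  have expand: "(1 - L) * dist x y \<le> dist (?h x) (?h y)" for x y
  proof -
    have "norm (x - y) \<le> norm (?h x - ?h y) + norm (g x - g y)"
      using norm_triangle_ineq4[of "?h x - ?h y" "g x - g y"] by (simp add: algebra_simps)
    moreover have "norm (g x - g y) \<le> L * norm (x - y)"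
      using lipschitz_onD[OF lip, of x y] by (simp add: dist_norm)
    ultimately show ?thesis by (simp add: dist_norm algebra_simps)
  qed
  have "\<exists>x. ?h x = y" for y
  proof -
    have "\<exists>!x. x \<in> UNIV \<and> y - g x = x"
    proof (rule Banach_fix[OF _ _ L0 L])
      show "dist (y - g x) (y - g z) \<le> L * dist x z" for x z
        using lipschitz_onD[OF lip, of x z] by (simp add: dist_norm norm_minus_commute)
    qed (auto simp: complete_UNIV)
    then show ?thesis by (metis diff_add_cancel)
  qed
  then obtain k where k: "\<And>y. ?h (k y) = y" by metis
  have kh: "k (?h x) = x" for x
  proof -
    have "(1 - L) * dist (k (?h x)) x \<le> 0"
      using expand[of "k (?h x)" x] by (simp add: k)
    then show ?thesis using L
      by (smt (verit, best) mult_pos_pos zero_less_dist_iff)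
  qed
  have lk: "(1 / (1 - L))-lipschitz_on UNIV k"
  proof (rule lipschitz_onI)
    fix x y show "dist (k x) (k y) \<le> 1 / (1 - L) * dist x y"
      using expand[of "k x" "k y"] L by (simp add: k field_simps)
  qed (use L in auto)
  have "homeomorphism UNIV UNIV ?h k"
    using k kh lipschitz_on_continuous_on[OF lk] lipschitz_on_continuous_on[OF lip]
    by (intro homeomorphismI continuous_on_add continuous_on_id) auto
  then show ?thesis using lk by (rule that)
qed

text \<open>
  The displacement \<open>c t \<mapsto> d t - c t\<close> is well defined on the image of \<open>c\<close> even where \<open>c\<close> is not injective, because
  the hypothesis with \<open>c t = c s\<close> forces equal displacements. After extension its Lipschitz constant is at most \<open>1/4\<close>,
  whence the constant \<open>4/3\<close> for the inverse.
\<close>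

lemma homeomorphism_of_lipschitz_perturbation:
  fixes c d :: "'i \<Rightarrow> 'a::euclidean_space" and L M :: real
  assumes lip: "\<And>s t. norm ((d t - c t) - (d s - c s)) \<le> L * norm (c t - c s)"
    and bd: "\<And>t. norm (d t - c t) \<le> M"
    and L: "0 \<le> L" "DIM('a) * L \<le> 1/4"
  obtains h k where "homeomorphism UNIV UNIV h k" "(4/3)-lipschitz_on UNIV k"
    "\<And>x. norm (h x - x) \<le> DIM('a) * M" "\<And>t. h (c t) = d t"
proof -
  have M: "0 \<le> M" using bd norm_ge_zero order_trans by blast
  \<comment> \<open>An arbitrary preimage is chosen; the displacement does not depend on it.\<close>
  define p where "p x = d (inv c x) - c (inv c x)" for x
  have pc: "p (c t) = d t - c t" for t
  proof -
    have "c (inv c (c t)) = c t" by (simp add: f_inv_into_f)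
    then show ?thesis using lip[of t "inv c (c t)"] by (simp add: p_def)
  qed
  have lp: "L-lipschitz_on (range c) p"
    using L lip by (intro lipschitz_onI) (auto simp: pc dist_norm)
  have bp: "norm (p x) \<le> M" if "x \<in> range c" for x
    using that bd by (auto simp: pc)
  from lipschitz_extension_euclidean[OF lp bp M] obtain g
    where "(DIM('a) * L)-lipschitz_on UNIV g \<and> (\<forall>x. norm (g x) \<le> DIM('a) * M) \<and>
      (\<forall>x\<in>range c. g x = p x)" ..
  note g0 = this
  note g = conjunct1[OF g0] conjunct2[OF g0, THEN conjunct1, THEN spec]
    conjunct2[OF g0, THEN conjunct2, THEN bspec, OF rangeI]
  have g4: "(1/4)-lipschitz_on UNIV g"
    by (rule lipschitz_on_mono[OF g(1) _ L(2)]) simp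
  then obtain k where "homeomorphism UNIV UNIV (\<lambda>x. x + g x) k" "(1 / (1 - 1/4))-lipschitz_on UNIV k"
    by (rule homeomorphism_id_plus_contraction) auto
  then show ?thesis
    by (intro that[of "\<lambda>x. x + g x" k]) (auto simp: g(2,3) pc)
qed

text \<open>
  Let \<open>F n\<close> be the composition of the first \<open>n\<close> homeomorphisms and \<open>G n\<close> its inverse. Increments of
  \<open>F\<close> are bounded by the displacements, of order \<open>2\<^sup>-\<^sup>n\<close>. Increments of \<open>G\<close> are bounded by the
  Lipschitz constant \<open>(4/3)\<^sup>n\<close> of \<open>G n\<close> times the displacement, of order \<open>(2/3)\<^sup>n\<close>. Both sequences
  therefore converge uniformly, and uniform limits of mutually inverse maps are mutually inverse. The limit
  curve \<open>d\<close> may fail to be a small Lipschitz perturbation of \<open>c 0\<close> although every single step is one.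
\<close>

lemma homeomorphism_infinite_composition:
  fixes c :: "nat \<Rightarrow> 'i \<Rightarrow> 'a::euclidean_space" and d :: "'i \<Rightarrow> 'a" and L M :: real
  assumes lip: "\<And>n s t. norm ((c (Suc n) t - c n t) - (c (Suc n) s - c n s)) \<le> L * norm (c n t - c n s)"
    and bd: "\<And>n t. norm (c (Suc n) t - c n t) \<le> M / 2 ^ n"
    and L: "0 \<le> L" "DIM('a) * L \<le> 1/4"
    and lim: "\<And>t. (\<lambda>n. c n t) \<longlonglongrightarrow> d t"
  obtains h k where "homeomorphism UNIV UNIV h k" "\<And>t. h (c 0 t) = d t"
proof -
  have "\<exists>h k. homeomorphism UNIV UNIV h k \<and> (4/3)-lipschitz_on UNIV k \<and>
     (\<forall>x. norm (h x - x) \<le> DIM('a) * (M / 2 ^ n)) \<and> (\<forall>t. h (c n t) = c (Suc n) t)" for n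
    using homeomorphism_of_lipschitz_perturbation[of "c (Suc n)" "c n" L "M / 2^n", OF lip bd L]
    by metis
  then obtain h k where hk: "\<And>n. homeomorphism UNIV UNIV (h n) (k n)"
      and kl: "\<And>n. (4/3)-lipschitz_on UNIV (k n)"
      and hb: "\<And>n x. norm (h n x - x) \<le> DIM('a) * (M / 2 ^ n)"
      and hc: "\<And>n t. h n (c n t) = c (Suc n) t"
    by metis
  have hk1: "h n (k n x) = x" and hk2: "k n (h n x) = x" for n x
    using hk[of n] by (auto simp: homeomorphism_def)
  have hcont: "continuous_on UNIV (h n)" and kcont: "continuous_on UNIV (k n)" for n
    using hk[of n] by (auto simp: homeomorphism_def)
  define F where "F = rec_nat id (\<lambda>n f. h n \<circ> f)"
  define G where "G = rec_nat id (\<lambda>n f. f \<circ> k n)"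
  have F: "F 0 = id" "F (Suc n) = h n \<circ> F n" and G: "G 0 = id" "G (Suc n) = G n \<circ> k n" for n
    by (simp_all add: F_def G_def)
  have FG: "F n (G n x) = x" and GF: "G n (F n x) = x" for n x
    by (induction n arbitrary: x) (simp_all add: F G hk1 hk2)
  have Fcont: "continuous_on UNIV (F n)" for n
    by (induction n) (auto simp: F intro!: continuous_on_compose2[OF hcont] continuous_on_id)
  have Glip: "((4/3) ^ n)-lipschitz_on UNIV (G n)" for n
  proof (induction n)
    case 0 show ?case by (simp add: G lipschitz_on_def)
  next
    case (Suc n)
    have "((4/3) ^ n * (4/3))-lipschitz_on UNIV (G n \<circ> k n)"
      by (rule lipschitz_on_compose[OF kl lipschitz_on_subset[OF Suc.IH]]) simp
    then show ?case by (simp add: G mult.commute)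
  qed
  have Gcont: "continuous_on UNIV (G n)" for n
    using lipschitz_on_continuous_on[OF Glip] .
  let ?C = "DIM('a) * M"
  have Fstep: "norm (F (Suc n) x - F n x) \<le> ?C * (1/2) ^ n" for n x
    using hb[of n "F n x"] by (simp add: F power_one_over field_simps)
  have Gstep: "norm (G (Suc n) x - G n x) \<le> ?C * (2/3) ^ n" for n x
  proof -
    have "norm (k n x - x) \<le> DIM('a) * (M / 2 ^ n)"
      using hb[of n "k n x"] by (simp add: hk1 norm_minus_commute)
    moreover have "norm (G (Suc n) x - G n x) \<le> (4/3) ^ n * norm (k n x - x)"
      using lipschitz_onD[OF Glip, of "k n x" x n] by (simp add: G dist_norm)
    ultimately have "norm (G (Suc n) x - G n x) \<le> (4/3) ^ n * (DIM('a) * (M / 2 ^ n))"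
      by (smt (verit) mult_left_mono zero_le_power divide_nonneg_nonneg)
    also have "\<dots> = ?C * (2/3) ^ n"
    proof -
      have "(4/3::real) ^ n / 2 ^ n = (2/3) ^ n"
        by (simp add: power_divide[symmetric])
      then show ?thesis by (simp add: field_simps)
    qed
    finally show ?thesis .
  qed
  have uconv: "\<exists>l. uniform_limit UNIV f l sequentially"
    if step: "\<And>n x. norm (f (Suc n) x - f n x) \<le> ?C * q ^ n" and q: "0 \<le> q" "q < 1"
    for f :: "nat \<Rightarrow> 'a \<Rightarrow> 'a" and q :: real
  proof -
    have "uniformly_convergent_on UNIV (\<lambda>n x. \<Sum>i<n. f (Suc i) x - f i x)"
      using step q
      by (intro Weierstrass_m_test'[where M = "\<lambda>n. ?C * q ^ n"])
        (auto intro!: summable_mult summable_geometric)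
    then obtain l where "uniform_limit UNIV (\<lambda>n x. \<Sum>i<n. f (Suc i) x - f i x) l sequentially"
      by (auto simp: uniformly_convergent_on_def)
    then have "uniform_limit UNIV (\<lambda>n x. f 0 x + (\<Sum>i<n. f (Suc i) x - f i x))
        (\<lambda>x. f 0 x + l x) sequentially"
      by (intro uniform_limit_add uniform_limit_const)
    moreover have "f 0 x + (\<Sum>i<n. f (Suc i) x - f i x) = f n x" for n x
      using sum_lessThan_telescope[of "\<lambda>i. f i x" n] by simp
    ultimately show ?thesis by auto
  qed
  obtain H where H: "uniform_limit UNIV F H sequentially"
    using uconv[of F "1/2"] Fstep by auto
  obtain K where K: "uniform_limit UNIV G K sequentially"
    using uconv[of G "2/3"] Gstep by auto
  have Hcont: "continuous_on UNIV H"
    by (rule uniform_limit_theorem[OF _ H]) (simp_all add: Fcont)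
  have Kcont: "continuous_on UNIV K"
    by (rule uniform_limit_theorem[OF _ K]) (simp_all add: Gcont)
  have inv: "Q (P x) = x"
    if P: "uniform_limit UNIV f P sequentially" and Q: "uniform_limit UNIV g Q sequentially"
      and cont: "continuous_on UNIV Q" and id: "\<And>n x. g n (f n x) = x"
    for f g :: "nat \<Rightarrow> 'a \<Rightarrow> 'a" and P Q x
  proof -
    have 1: "(\<lambda>n. f n x) \<longlonglongrightarrow> P x"
      using tendsto_uniform_limitI[OF P] by simp
    have "(\<lambda>n. Q (f n x)) \<longlonglongrightarrow> Q (P x)"
      using continuous_on_tendsto_compose[OF cont 1] by simp
    moreover have "(\<lambda>n. Q (f n x)) \<longlonglongrightarrow> x"
    proof (rule LIMSEQ_I)
      fix e :: real assume "e > 0"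
      then obtain N where "\<And>n y. n \<ge> N \<Longrightarrow> dist (g n y) (Q y) < e"
        using Q unfolding uniform_limit_iff eventually_sequentially by blast
      then have "norm (Q (f n x) - x) < e" if "n \<ge> N" for n
        using that id[of n x] by (metis dist_norm dist_commute)
      then show "\<exists>N. \<forall>n\<ge>N. norm (Q (f n x) - x) < e" by blast
    qed
    ultimately show ?thesis by (rule LIMSEQ_unique)
  qed
  have KH: "K (H x) = x" for x using inv[OF H K Kcont GF] .
  have HK: "H (K x) = x" for x using inv[OF K H Hcont FG] .
  have "homeomorphism UNIV UNIV H K"
    using Hcont Kcont KH HK by (intro homeomorphismI) auto
  moreover have "H (c 0 t) = d t" for t
  proof -
    have "F n (c 0 t) = c n t" for n
      by (induction n) (simp_all add: F hc)
    then have "(\<lambda>n. c n t) \<longlonglongrightarrow> H (c 0 t)"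
      using tendsto_uniform_limitI[OF H, of "c 0 t"] by simp
    then show ?thesis using lim by (rule LIMSEQ_unique)
  qed
  ultimately show ?thesis by (rule that)
qed

section \<open>Averages of almost straight curves\<close>

definition window_average :: "(real \<Rightarrow> 'a::euclidean_space) \<Rightarrow> real \<Rightarrow> real \<Rightarrow> 'a" where
  "window_average c r t = (1 / r) *\<^sub>R integral {t..t+r} c"

lemma window_average_diff_shift:
  assumes c: "continuous_on UNIV c"
  shows "window_average c r t - window_average c r s =
    (1 / r) *\<^sub>R integral {0..r} (\<lambda>x. c (t + x) - c (s + x))"
proof -
  have shift: "integral {a..a+r} c = integral {0..r} (\<lambda>x. c (a + x))" for a
    using integral_shift[of 0 a r c] continuous_on_subset[OF c]
    by (simp add: o_def add.commute)
  have int: "(\<lambda>x. c (a + x)) integrable_on {0..r}" for a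
    by (intro integrable_continuous_interval continuous_intros continuous_on_compose2[OF c]) auto
  show ?thesis
    by (simp add: window_average_def shift integral_diff int scaleR_diff_right)
qed

text \<open>
  The averaged curve is \<open>C\<^sup>1\<close>, and its derivative is the difference quotient of \<open>c\<close> at scale \<open>r\<close>. The
  integrated form below avoids derivatives altogether.
\<close>

lemma window_average_diff_quotient:
  assumes c: "continuous_on UNIV c" and r: "0 < r" and st: "s \<le> t"
  shows "window_average c r t - window_average c r s =
    integral {s..t} (\<lambda>u. (1 / r) *\<^sub>R (c (u + r) - c u))"
proof -
  have ci: "c integrable_on {a..b}" for a b
    using continuous_on_subset[OF c] by (intro integrable_continuous_interval) auto
  have int: "(\<lambda>u. c (u + r)) integrable_on {s..t}"
    by (intro integrable_continuous_interval continuous_intros continuous_on_compose2[OF c]) auto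
  have shift: "integral {s+r..t+r} c = integral {s..t} (\<lambda>u. c (u + r))"
    using integral_shift[of s r t c] continuous_on_subset[OF c] by (simp add: o_def)
  have "integral {s..s+r} c + integral {s+r..t+r} c = integral {s..t+r} c"
    using r st by (intro Henstock_Kurzweil_Integration.integral_combine ci) auto
  moreover have "integral {s..t} c + integral {t..t+r} c = integral {s..t+r} c"
    using r st by (intro Henstock_Kurzweil_Integration.integral_combine ci) auto
  ultimately have "integral {t..t+r} c - integral {s..s+r} c = integral {s..t} (\<lambda>u. c (u + r) - c u)"
    unfolding integral_diff[OF int ci] shift[symmetric] by (simp add: algebra_simps)
  then show ?thesis
    by (simp add: window_average_def flip: scaleR_diff_right)
qed

lemma integral_inner_lower_bound:
  fixes f :: "real \<Rightarrow> 'a::euclidean_space"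
  assumes f: "continuous_on {a..b} f" and ab: "a \<le> b"
    and m: "\<And>x. x \<in> {a..b} \<Longrightarrow> m \<le> f x \<bullet> e"
  shows "m * (b - a) \<le> integral {a..b} f \<bullet> e"
proof -
  have fi: "f integrable_on {a..b}" using f by (rule integrable_continuous_interval)
  have "integral {a..b} (\<lambda>x. m) \<le> integral {a..b} (\<lambda>x. f x \<bullet> e)"
    using f m by (intro integral_le integrable_continuous_interval continuous_intros) auto
  also have "\<dots> = integral {a..b} f \<bullet> e"
    using integral_linear[OF fi bounded_linear_inner_left[of e]] by (simp add: o_def)
  finally show ?thesis using ab by (simp add: mult.commute)
qed

lemma window_average_approx:
  assumes lip: "\<And>s t. norm (c t - c s) \<le> \<bar>t - s\<bar>" and r: "0 < r"
  shows "norm (window_average c r t - c t) \<le> r"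
proof -
  have c: "continuous_on UNIV c"
    using lip by (intro lipschitz_on_continuous_on[of 1] lipschitz_onI) (auto simp: dist_norm)
  have ct: "continuous_on {t..t+r} (\<lambda>x. c x - c t)"
    using c by (intro continuous_intros) (auto intro: continuous_on_subset)
  have "norm (integral {t..t+r} (\<lambda>x. c x - c t)) \<le> r * (t + r - t)"
  proof (rule integral_bound[OF _ ct])
    show "norm (c x - c t) \<le> r" if "x \<in> {t..t+r}" for x
      using lip[of x t] that by auto
  qed (use r in auto)
  moreover have "integral {t..t+r} (\<lambda>x. c x - c t) = integral {t..t+r} c - r *\<^sub>R c t"
    using r continuous_on_subset[OF c]
    by (subst integral_diff) (auto intro!: integrable_continuous_interval)
  ultimately have "norm (integral {t..t+r} c - r *\<^sub>R c t) \<le> r * r" by simp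
  moreover have "window_average c r t - c t = (1 / r) *\<^sub>R (integral {t..t+r} c - r *\<^sub>R c t)"
    using r by (simp add: window_average_def scaleR_diff_right)
  ultimately show ?thesis using r by (simp add: divide_le_eq)
qed

lemma continuous_on_window_average_quotient:
  fixes c :: "real \<Rightarrow> 'a::euclidean_space"
  assumes "continuous_on UNIV c"
  shows "continuous_on A (\<lambda>u. (1 / r) *\<^sub>R (c (u + r) - c u))"
  by (intro continuous_intros continuous_on_compose2[OF assms]) auto

text \<open>
  Let \<open>e\<close> be the direction of the chord from \<open>c s\<close> to \<open>c (t + r)\<close>. Because \<open>c\<close> is \<open>1\<close>-Lipschitz and this chord is
  almost as long as its arc, no subarc can lose more than the total defect \<open>\<delta> l\<close> in the direction \<open>e\<close>.
  Averaging the progress of subarcs along \<open>e\<close> gives the bound: subarcs \<open>[u, u + r]\<close> if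
  \<open>t - s \<le> r\<close>, subarcs \<open>[s + x, t + x]\<close> otherwise. In both cases the subarcs
  have at least half the length of \<open>[s, t + r]\<close>, so the relative defect is at most \<open>2 \<delta>\<close>.
\<close>

lemma window_average_expands:
  fixes c :: "real \<Rightarrow> 'a::euclidean_space"
  assumes lip: "\<And>s t. norm (c t - c s) \<le> \<bar>t - s\<bar>"
    and chord: "\<And>t r. 0 < r \<Longrightarrow> r \<le> \<rho> \<Longrightarrow> (1 - \<delta>) * r \<le> norm (c (t + r) - c t)"
    and \<delta>: "0 \<le> \<delta>" "\<delta> < 1" and r: "0 < r" "2 * r \<le> \<rho>" and st: "s \<le> t" "t - s \<le> \<rho> - r"
  shows "(1 - 2 * \<delta>) * (t - s) \<le> norm (window_average c r t - window_average c r s)"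
proof -
  have c: "continuous_on UNIV c"
    using lip by (intro lipschitz_on_continuous_on[of 1] lipschitz_onI) (auto simp: dist_norm)
  let ?W = "window_average c r t - window_average c r s"
  define l where "l = t - s + r"
  have l: "0 < l" "l \<le> \<rho>" "s + l = t + r" using r st by (auto simp: l_def)
  define e where "e = sgn (c (t + r) - c s)"
  have ch: "(1 - \<delta>) * l \<le> norm (c (t + r) - c s)" using chord[OF l(1,2), of s] l(3) by simp
  then have "c (t + r) - c s \<noteq> 0" using \<delta> l(1) by (smt (verit) mult_pos_pos norm_zero)
  then have e1: "norm e = 1" by (simp add: e_def norm_sgn)
  have e2: "(1 - \<delta>) * l \<le> (c (t + r) - c s) \<bullet> e"
  proof -
    have "(c (t + r) - c s) \<bullet> e = norm (c (t + r) - c s)"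
      using e1 by (simp add: e_def sgn_div_norm power2_norm_eq_inner[symmetric] power2_eq_square)
    then show ?thesis using ch by simp
  qed
  have ie: "(c y - c x) \<bullet> e \<le> y - x" if "x \<le> y" for x y
    using norm_cauchy_schwarz[of "c y - c x" e] lip[of y x] e1 that by simp
  \<comment> \<open>The two arcs that complete \<open>[x, y]\<close> advance along \<open>e\<close> by at most their lengths.\<close>
  have sub: "(1 - \<delta>) * l - (l - (y - x)) \<le> (c y - c x) \<bullet> e"
    if "s \<le> x" "x \<le> y" "y \<le> t + r" for x y
  proof -
    have "(c (t + r) - c s) \<bullet> e = (c y - c x) \<bullet> e + (c x - c s) \<bullet> e + (c (t + r) - c y) \<bullet> e"
      by (simp add: inner_diff_left)
    then show ?thesis using e2 ie[of s x] ie[of y "t + r"] that l(3) by (simp add: algebra_simps)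
  qed
  have "(1 - 2 * \<delta>) * (t - s) \<le> ?W \<bullet> e"
  proof (cases "t - s \<le> r")
    case True
    have "(1 - 2 * \<delta>) \<le> ((1 / r) *\<^sub>R (c (u + r) - c u)) \<bullet> e" if "u \<in> {s..t}" for u
    proof -
      have "\<delta> * l \<le> \<delta> * (2 * r)" using True \<delta> by (intro mult_left_mono) (auto simp: l_def)
      then have "(1 - 2 * \<delta>) * r \<le> (c (u + r) - c u) \<bullet> e"
        using sub[of u "u + r"] that r by (simp add: algebra_simps)
      then show ?thesis using r by (simp add: le_divide_eq)
    qed
    then have "(1 - 2 * \<delta>) * (t - s) \<le> integral {s..t} (\<lambda>u. (1 / r) *\<^sub>R (c (u + r) - c u)) \<bullet> e"
      using st by (intro integral_inner_lower_bound continuous_on_window_average_quotient[OF c]) auto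
    then show ?thesis
      by (simp add: window_average_diff_quotient[OF c r(1) st(1)])
  next
    case False
    have "(1 - 2 * \<delta>) * (t - s) \<le> (c (t + x) - c (s + x)) \<bullet> e" if "x \<in> {0..r}" for x
    proof -
      have "\<delta> * l \<le> \<delta> * (2 * (t - s))" using False \<delta> by (intro mult_left_mono) (auto simp: l_def)
      then show ?thesis
        using sub[of "s + x" "t + x"] that r st by (simp add: algebra_simps)
    qed
    then have "(1 - 2 * \<delta>) * (t - s) * (r - 0) \<le>
        integral {0..r} (\<lambda>x. c (t + x) - c (s + x)) \<bullet> e"
      using r by (intro integral_inner_lower_bound continuous_intros continuous_on_compose2[OF c]) auto
    then show ?thesis
      using r by (simp add: window_average_diff_shift[OF c] field_simps)
  qed
  also have "\<dots> \<le> norm ?W" using norm_cauchy_schwarz[of ?W e] e1 by simp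
  finally show ?thesis .
qed

text \<open>
  Parallelogram law for the two half chords: each has length at most \<open>h\<close>, and their sum is nearly of length
  \<open>2 h\<close>, so their difference is small.
\<close>

lemma second_difference_bound:
  fixes c :: "real \<Rightarrow> 'a::real_inner"
  assumes lip: "\<And>s t. norm (c t - c s) \<le> \<bar>t - s\<bar>"
    and chord: "(1 - \<delta>) * (2 * h) \<le> norm (c (u + 2 * h) - c u)" and \<delta>: "\<delta> \<le> 1" and h: "0 < h"
  shows "(norm (c (u + 2 * h) - 2 *\<^sub>R c (u + h) + c u))\<^sup>2 \<le> 8 * \<delta> * h\<^sup>2"
proof -
  let ?a = "c (u + h) - c u" and ?b = "c (u + 2 * h) - c (u + h)"
  have "(norm ?a)\<^sup>2 \<le> h\<^sup>2" "(norm ?b)\<^sup>2 \<le> h\<^sup>2"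
    using lip[of "u + h" u] lip[of "u + 2 * h" "u + h"] h by (auto intro!: power_mono)
  moreover have "((1 - \<delta>) * (2 * h))\<^sup>2 \<le> (norm (?a + ?b))\<^sup>2"
    using chord \<delta> h by (intro power_mono) auto
  moreover have "(norm (?b - ?a))\<^sup>2 = 2 * (norm ?a)\<^sup>2 + 2 * (norm ?b)\<^sup>2 - (norm (?a + ?b))\<^sup>2"
    by (simp add: power2_norm_eq_inner inner_commute algebra_simps)
  moreover have "((1 - \<delta>) * (2 * h))\<^sup>2 = 4 * h\<^sup>2 - 8 * \<delta> * h\<^sup>2 + 4 * (\<delta> * h)\<^sup>2"
    by (simp add: power2_eq_square algebra_simps)
  moreover have "0 \<le> (\<delta> * h)\<^sup>2" by simp
  ultimately have "(norm (?b - ?a))\<^sup>2 \<le> 8 * \<delta> * h\<^sup>2" by linarith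
  moreover have "?b - ?a = c (u + 2 * h) - 2 *\<^sub>R c (u + h) + c u"
    by (simp add: scaleR_2)
  ultimately show ?thesis by simp
qed

text \<open>
  Shifting \<open>t\<close> by the integer nearest to \<open>t - s\<close> brings any pair within distance \<open>1/2\<close>, half the length of the circle.
\<close>

lemma periodic_pair_reduction:
  fixes P :: "real \<Rightarrow> real \<Rightarrow> bool"
  assumes sym: "\<And>s t. P s t \<Longrightarrow> P t s" and per: "\<And>s t n::int. P s (t + of_int n) \<Longrightarrow> P s t"
    and P: "\<And>s t. s \<le> t \<Longrightarrow> t - s \<le> 1/2 \<Longrightarrow> P s t"
  shows "P s t"
proof -
  define n where "n = - round (t - s)"
  have "\<bar>t + of_int n - s\<bar> \<le> 1/2"
    using of_int_round_abs_le[of "t - s"] by (simp add: n_def abs_minus_commute algebra_simps)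
  then have "P s (t + of_int n)"
    using P[of s "t + of_int n"] P[of "t + of_int n" s] sym by (cases "s \<le> t + of_int n") auto
  then show ?thesis by (rule per)
qed

lemma window_average_periodic:
  assumes "\<And>x n. c (x + of_int n) = c (x::real)" and c: "continuous_on UNIV c"
  shows "window_average c r (t + of_int n) = window_average c r t"
proof -
  have "c (t + of_int n + x) = c (t + x)" for x
    using assms(1)[of "t + x" n] by (simp add: add_ac)
  then show ?thesis
    using window_average_diff_shift[OF c, of r "t + of_int n" t] by simp
qed

lemma window_average_diff_le:
  assumes c: "continuous_on UNIV c" and d: "continuous_on UNIV d" and r: "0 < r"
    and bd: "\<And>t. norm (d t - c t) \<le> \<epsilon>"
  shows "norm (window_average d r t - window_average c r t) \<le> \<epsilon>"
proof -
  have ci: "c integrable_on {a..b}" and di: "d integrable_on {a..b}" for a b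
    using continuous_on_subset[OF c] continuous_on_subset[OF d]
    by (auto intro: integrable_continuous_interval)
  have "norm (integral {t..t+r} (\<lambda>x. d x - c x)) \<le> \<epsilon> * (t + r - t)"
    using r bd continuous_on_subset[OF c] continuous_on_subset[OF d]
    by (intro integral_bound continuous_intros) auto
  moreover have "window_average d r t - window_average c r t =
      (1 / r) *\<^sub>R integral {t..t+r} (\<lambda>x. d x - c x)"
    by (simp add: window_average_def integral_diff[OF di ci] scaleR_diff_right)
  ultimately show ?thesis using r by (simp add: divide_le_eq)
qed

section \<open>Homeomorphisms between almost straight curves\<close>

text \<open>
  Chords are tested up to length \<open>2 \<rho>\<close>, twice the distance up to which averages are
  compared, because the arcs that enter are longer by the width of the averaging window. The defect
  \<open>1/400\<close> is a numerical choice: by \<open>second_difference_bound\<close>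
  it makes consecutive averages differ with slope at most \<open>2/25\<close>, which
  is below \<open>1/12\<close> of their expansion constant \<open>199/200\<close>, and \<open>1/12\<close> leaves the
  contraction constant \<open>1/4\<close> after the extension to three dimensions.
\<close>

definition nearly_straight :: "real \<Rightarrow> (real \<Rightarrow> 'a::euclidean_space) \<Rightarrow> bool" where
  "nearly_straight \<rho> c \<longleftrightarrow> (\<forall>x n. c (x + of_int n) = c x) \<and>
     (\<forall>s t. norm (c t - c s) \<le> \<bar>t - s\<bar>) \<and>
     (\<forall>t r. 0 < r \<longrightarrow> r \<le> 2 * \<rho> \<longrightarrow> (1 - 1/400) * r \<le> norm (c (t + r) - c t))"

lemma nearly_straightD:
  assumes "nearly_straight \<rho> c"
  shows "c (x + of_int n) = c x" "norm (c t - c s) \<le> \<bar>t - s\<bar>"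
    "0 < r \<Longrightarrow> r \<le> 2 * \<rho> \<Longrightarrow> (1 - 1/400) * r \<le> norm (c (t + r) - c t)"
    "continuous_on UNIV c"
proof -
  show lip: "norm (c t - c s) \<le> \<bar>t - s\<bar>" for s t
    using assms by (simp add: nearly_straight_def)
  show "continuous_on UNIV c"
    using lip by (intro lipschitz_on_continuous_on[of 1] lipschitz_onI) (auto simp: dist_norm)
qed (use assms in \<open>simp_all add: nearly_straight_def\<close>)

definition separated :: "real \<Rightarrow> real \<Rightarrow> (real \<Rightarrow> 'a::euclidean_space) \<Rightarrow> bool" where
  "separated \<rho> m c \<longleftrightarrow> (\<forall>s t. \<rho> \<le> t - s \<longrightarrow> t - s \<le> 1/2 \<longrightarrow> m \<le> norm (c t - c s))"

text \<open>
  Near pairs are compared through slopes. For far pairs smallness of the displacement itself suffices,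
  because their images are separated.
\<close>

lemma perturbation_estimate:
  fixes W W' :: "real \<Rightarrow> 'a::euclidean_space"
  assumes per: "\<And>x n. W (x + of_int n) = W x" "\<And>x n. W' (x + of_int n) = W' x"
    and slow: "\<And>s t. s \<le> t \<Longrightarrow> t - s \<le> \<rho> \<Longrightarrow> norm ((W' t - W t) - (W' s - W s)) \<le> 2/25 * (t - s)"
    and expand: "\<And>s t. s \<le> t \<Longrightarrow> t - s \<le> \<rho> \<Longrightarrow> (1 - 2 * (1/400)) * (t - s) \<le> norm (W t - W s)"
    and small: "\<And>t. norm (W' t - W t) \<le> \<epsilon>" and sep: "separated \<rho> (24 * \<epsilon>) W"
  shows "norm ((W' t - W t) - (W' s - W s)) \<le> 1/12 * norm (W t - W s)"
proof (rule periodic_pair_reduction[where P = "\<lambda>s t. norm ((W' t - W t) - (W' s - W s)) \<le> 1/12 * norm (W t - W s)"])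
  fix s t :: real assume st: "s \<le> t" "t - s \<le> 1/2"
  show "norm ((W' t - W t) - (W' s - W s)) \<le> 1/12 * norm (W t - W s)"
  proof (cases "t - s \<le> \<rho>")
    case True
    then show ?thesis using slow[OF st(1) True] expand[OF st(1) True] st by simp
  next
    case False
    then have "24 * \<epsilon> \<le> norm (W t - W s)" using sep st by (simp add: separated_def)
    moreover have "norm ((W' t - W t) - (W' s - W s)) \<le> \<epsilon> + \<epsilon>"
      using small[of t] small[of s] by (intro norm_triangle_le_diff) simp
    ultimately show ?thesis by simp
  qed
next
  fix s t assume "norm ((W' t - W t) - (W' s - W s)) \<le> 1/12 * norm (W t - W s)"
  then show "norm ((W' s - W s) - (W' t - W t)) \<le> 1/12 * norm (W s - W t)"
    by (simp only: norm_minus_commute[of "W' s - W s"] norm_minus_commute[of "W s"])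
qed (simp only: per)

lemma separated_window_average:
  assumes c: "nearly_straight \<rho> c" and sep: "separated \<rho> m c" and r: "0 < r"
  shows "separated \<rho> (m - 2 * r) (window_average c r)"
  unfolding separated_def
proof (intro allI impI)
  fix s t :: real assume "\<rho> \<le> t - s" "t - s \<le> 1/2"
  then have "m \<le> norm (c t - c s)" using sep by (simp add: separated_def)
  moreover have "norm (window_average c r x - c x) \<le> r" for x
    using nearly_straightD(2)[OF c] r by (rule window_average_approx)
  from this[of s] this[of t]
  have "norm (c t - c s) \<le> norm (window_average c r t - window_average c r s) + 2 * r"
    by norm
  ultimately show "m - 2 * r \<le> norm (window_average c r t - window_average c r s)" by simp
qed

lemma norm_integral_le:
  fixes f :: "real \<Rightarrow> 'a::euclidean_space"
  assumes "continuous_on UNIV f" "s \<le> t" "\<And>u. norm (f u) \<le> B"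
  shows "norm (integral {s..t} f) \<le> B * (t - s)"
  using assms by (intro integral_bound) (auto intro: continuous_on_subset)

lemma window_average_difference_slow:
  assumes c: "continuous_on UNIV c" and d: "continuous_on UNIV d" and r: "0 < r" "0 < r'" and st: "s \<le> t"
    and B: "\<And>u. norm ((1 / r') *\<^sub>R (d (u + r') - d u) - (1 / r) *\<^sub>R (c (u + r) - c u)) \<le> B"
  shows "norm ((window_average d r' t - window_average c r t) -
    (window_average d r' s - window_average c r s)) \<le> B * (t - s)"
proof -
  let ?f = "\<lambda>u. (1 / r') *\<^sub>R (d (u + r') - d u)" and ?g = "\<lambda>u. (1 / r) *\<^sub>R (c (u + r) - c u)"
  have f: "continuous_on A ?f" and g: "continuous_on A ?g" for A
    using c d by (auto intro: continuous_on_window_average_quotient)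
  have "(window_average d r' t - window_average c r t) - (window_average d r' s - window_average c r s)
      = integral {s..t} ?f - integral {s..t} ?g"
    unfolding window_average_diff_quotient[OF d r(2) st, symmetric]
      window_average_diff_quotient[OF c r(1) st, symmetric] by simp
  also have "\<dots> = integral {s..t} (\<lambda>u. ?f u - ?g u)"
    by (intro integral_diff[symmetric] integrable_continuous_interval f g)
  also have "norm \<dots> \<le> B * (t - s)"
    using f g st B by (intro norm_integral_le continuous_on_diff) auto
  finally show ?thesis .
qed

lemma quotient_difference:
  fixes a b z :: "'a::real_vector"
  shows "(2 * q) *\<^sub>R (a - z) - q *\<^sub>R (b - z) = - (q *\<^sub>R (b - 2 *\<^sub>R a + z))"
  by (simp add: algebra_simps flip: scaleR_add_left)

text \<open>
  The averages at scales \<open>r / 2\<^sup>n\<close> are consecutive small Lipschitz perturbations with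
  displacement at most \<open>2 r / 2\<^sup>n\<close>, and they converge to the curve.
\<close>

lemma homeomorphism_window_average_to_curve:
  fixes c :: "real \<Rightarrow> real^3"
  assumes c: "nearly_straight \<rho> c" and sep: "separated \<rho> m c" and r: "0 < r" "r \<le> \<rho>" "50 * r \<le> m"
  obtains h k where "homeomorphism UNIV UNIV h k" "\<And>t. h (window_average c r t) = c t"
proof -
  note cD = nearly_straightD[OF c]
  define R where "R n = r / 2 ^ n" for n :: nat
  have R: "0 < R n" "R n \<le> r" "R (Suc n) = R n / 2" for n
    using r by (auto simp: R_def field_simps)
  have approx: "norm (window_average c (R n) t - c t) \<le> R n" for n t
    using cD(2) R(1) by (rule window_average_approx)
  have step: "norm (window_average c (R (Suc n)) t - window_average c (R n) t) \<le> 2 * R n" for n t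
    using dist_triangle2[of "window_average c (R (Suc n)) t" "window_average c (R n) t" "c t"]
      approx[of n t] approx[of "Suc n" t] R(1)[of n] R(3)[of n]
    unfolding dist_norm by linarith
  have quot: "norm ((1 / R (Suc n)) *\<^sub>R (c (u + R (Suc n)) - c u) - (1 / R n) *\<^sub>R (c (u + R n) - c u)) \<le> 2/25" for n u
  proof -
    let ?h = "R (Suc n)"
    have h: "R n = 2 * ?h" "0 < ?h" using R(1,3)[of n] by auto
    have "(norm (c (u + 2 * ?h) - 2 *\<^sub>R c (u + ?h) + c u))\<^sup>2 \<le> 8 * (1/400) * ?h\<^sup>2"
      using cD(2) cD(3)[of "2 * ?h" u] h R(2)[of n] r
      by (intro second_difference_bound) auto
    also have "\<dots> \<le> (4/25 * ?h)\<^sup>2" by (simp add: power2_eq_square)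
    finally have "norm (c (u + 2 * ?h) - 2 *\<^sub>R c (u + ?h) + c u) \<le> 4/25 * ?h"
      by (rule power2_le_imp_le) (use h in simp)
    moreover have "(1 / ?h) *\<^sub>R (c (u + ?h) - c u) - (1 / R n) *\<^sub>R (c (u + R n) - c u) =
        - ((1 / R n) *\<^sub>R (c (u + 2 * ?h) - 2 *\<^sub>R c (u + ?h) + c u))"
    proof -
      have "1 / ?h = 2 * (1 / R n)" using h by simp
      then show ?thesis
        unfolding h(1)[symmetric] by (simp only: quotient_difference)
    qed
    ultimately show ?thesis using h by (simp add: divide_le_eq)
  qed
  have est: "norm ((window_average c (R (Suc n)) t - window_average c (R n) t) -
      (window_average c (R (Suc n)) s - window_average c (R n) s))
      \<le> 1/12 * norm (window_average c (R n) t - window_average c (R n) s)" for n s t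
  proof (rule perturbation_estimate[where \<rho> = \<rho> and \<epsilon> = "2 * R n"])
    show "norm ((window_average c (R (Suc n)) t - window_average c (R n) t) -
      (window_average c (R (Suc n)) s - window_average c (R n) s)) \<le> 2/25 * (t - s)" if "s \<le> t" for s t
      using quot that by (intro window_average_difference_slow cD(4) R(1)) auto
    show "(1 - 2 * (1/400)) * (t - s) \<le> norm (window_average c (R n) t - window_average c (R n) s)"
      if "s \<le> t" "t - s \<le> \<rho>" for s t
      using that R(1,2)[of n] r cD(2,3)
      by (intro window_average_expands[where \<rho> = "2 * \<rho>"]) auto
    show "separated \<rho> (24 * (2 * R n)) (window_average c (R n))"
    proof -
      have "24 * (2 * R n) \<le> m - 2 * R n" using R(2)[of n] r by simp
      then show ?thesis
        using separated_window_average[OF c sep R(1)[of n]]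
        unfolding separated_def by (meson order_trans)
    qed
  qed (use step cD(1,4) in \<open>auto intro: window_average_periodic\<close>)
  have lim: "(\<lambda>n. window_average c (R n) t) \<longlonglongrightarrow> c t" for t
  proof -
    have "R \<longlonglongrightarrow> 0"
      unfolding R_def using LIMSEQ_divide_realpow_zero[of 2 r] by simp
    then have "(\<lambda>n. window_average c (R n) t - c t) \<longlonglongrightarrow> 0"
      by (rule Lim_null_comparison[rotated]) (simp add: approx)
    then show ?thesis by (simp add: LIM_zero_iff)
  qed
  have R0: "R 0 = r" by (simp add: R_def)
  obtain h k where "homeomorphism UNIV UNIV h k" "\<And>t. h (window_average c (R 0) t) = c t"
  proof (rule homeomorphism_infinite_composition[of "\<lambda>n. window_average c (R n)" "1/12" "2 * r" c])
    show "norm (window_average c (R (Suc n)) t - window_average c (R n) t) \<le> 2 * r / 2 ^ n" for n t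
      using step[of n t] by (simp add: R_def)
  qed (use est lim in auto)
  then show ?thesis by (intro that) (auto simp: R0)
qed

text \<open>
  At a fixed averaging scale uniform closeness of two curves implies closeness of the
  derivatives of their averages, since these are difference quotients over the length \<open>r\<close>. This is why the
  admissible distance \<open>r / 25\<close> is proportional to \<open>r\<close>.
\<close>

lemma homeomorphism_between_window_averages:
  fixes c d :: "real \<Rightarrow> real^3"
  assumes c: "nearly_straight \<rho> c" and d: "nearly_straight \<rho> d" and sep: "separated \<rho> m c"
    and r: "0 < r" "r \<le> \<rho>" "50 * r \<le> m" and cd: "\<And>t. norm (d t - c t) \<le> r / 25"
  obtains h k where "homeomorphism UNIV UNIV h k" "\<And>t. h (window_average c r t) = window_average d r t"
proof -
  note cD = nearly_straightD[OF c] and dD = nearly_straightD[OF d]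
  have small: "norm (window_average d r t - window_average c r t) \<le> r / 25" for t
    using cD(4) dD(4) r(1) cd by (rule window_average_diff_le)
  have quot: "norm ((1 / r) *\<^sub>R (d (u + r) - d u) - (1 / r) *\<^sub>R (c (u + r) - c u)) \<le> 2/25" for u
  proof -
    have "norm ((d (u + r) - c (u + r)) - (d u - c u)) \<le> r / 25 + r / 25"
      using cd[of "u + r"] cd[of u] by (intro norm_triangle_le_diff) simp
    moreover have "(1 / r) *\<^sub>R (d (u + r) - d u) - (1 / r) *\<^sub>R (c (u + r) - c u) =
        (1 / r) *\<^sub>R ((d (u + r) - c (u + r)) - (d u - c u))"
      by (simp add: algebra_simps)
    ultimately show ?thesis using r(1) by (simp add: divide_le_eq)
  qed
  have est: "norm ((window_average d r t - window_average c r t) -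
      (window_average d r s - window_average c r s))
      \<le> 1/12 * norm (window_average c r t - window_average c r s)" for s t
  proof (rule perturbation_estimate[where \<rho> = \<rho> and \<epsilon> = "r / 25"])
    show "norm ((window_average d r t - window_average c r t) -
      (window_average d r s - window_average c r s)) \<le> 2/25 * (t - s)" if "s \<le> t" for s t
      using quot that r by (intro window_average_difference_slow cD(4) dD(4)) auto
    show "(1 - 2 * (1/400)) * (t - s) \<le> norm (window_average c r t - window_average c r s)"
      if "s \<le> t" "t - s \<le> \<rho>" for s t
      using that r cD(2,3)
      by (intro window_average_expands[where \<rho> = "2 * \<rho>"]) auto
    show "separated \<rho> (24 * (r / 25)) (window_average c r)"
    proof -
      have "24 * (r / 25) \<le> m - 2 * r" using r by simp
      then show ?thesis
        using separated_window_average[OF c sep r(1)]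
        unfolding separated_def by (meson order_trans)
    qed
  qed (use small cD(1,4) dD(1,4) in \<open>auto intro: window_average_periodic\<close>)
  show ?thesis
    by (rule homeomorphism_of_lipschitz_perturbation[of "window_average d r" "window_average c r"
          "1/12" "r / 25", OF est small]) (auto intro: that)
qed

lemma separated_of_close:
  assumes sep: "separated \<rho> m c" and cd: "\<And>t. norm (d t - c t) \<le> \<epsilon>"
  shows "separated \<rho> (m - 2 * \<epsilon>) d"
  unfolding separated_def
proof (intro allI impI)
  fix s t :: real assume "\<rho> \<le> t - s" "t - s \<le> 1/2"
  then have "m \<le> norm (c t - c s)" using sep by (simp add: separated_def)
  then show "m - 2 * \<epsilon> \<le> norm (d t - d s)" using cd[of s] cd[of t] by norm
qed

lemma homeomorphism_of_nearly_straight_curves: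
  fixes c d :: "real \<Rightarrow> real^3"
  assumes c: "nearly_straight \<rho> c" and d: "nearly_straight \<rho> d" and sep: "separated \<rho> m c"
    and r: "0 < r" "r \<le> \<rho>" "100 * r \<le> m" and cd: "\<And>t. norm (d t - c t) \<le> r / 25"
  shows "\<exists>h k. homeomorphism UNIV UNIV h k \<and> (\<forall>t. h (d t) = c t)"
proof -
  have sepd: "separated \<rho> (m - 2 * (r / 25)) d" using sep cd by (rule separated_of_close)
  obtain h1 k1 where 1: "homeomorphism UNIV UNIV h1 k1" "\<And>t. h1 (window_average c r t) = c t"
    by (rule homeomorphism_window_average_to_curve[OF c sep r(1,2)]) (use r in auto)
  obtain h2 k2 where 2: "homeomorphism UNIV UNIV h2 k2" "\<And>t. h2 (window_average d r t) = d t"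
    by (rule homeomorphism_window_average_to_curve[OF d sepd r(1,2)]) (use r in auto)
  obtain h3 k3 where 3: "homeomorphism UNIV UNIV h3 k3"
      "\<And>t. h3 (window_average c r t) = window_average d r t"
    by (rule homeomorphism_between_window_averages[OF c d sep r(1,2) _ cd]) (use r in auto)
  have "homeomorphism UNIV UNIV (h1 \<circ> (k3 \<circ> k2)) ((h2 \<circ> h3) \<circ> k1)"
    by (rule homeomorphism_compose[OF homeomorphism_compose[OF
          homeomorphism_sym[THEN iffD1, OF 2(1)] homeomorphism_sym[THEN iffD1, OF 3(1)]] 1(1)])
  moreover have "(h1 \<circ> (k3 \<circ> k2)) (d t) = c t" for t
  proof -
    have "k2 (d t) = window_average d r t"
      using homeomorphism_apply1[OF 2(1)] 2(2) by (metis UNIV_I)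
    moreover have "k3 (window_average d r t) = window_average c r t"
      using homeomorphism_apply1[OF 3(1)] 3(2) by (metis UNIV_I)
    ultimately show ?thesis by (simp add: 1(2))
  qed
  ultimately show ?thesis by (intro exI conjI allI)
qed

lemma inj_on_of_nearly_straight_separated:
  assumes c: "nearly_straight \<rho> c" and \<rho>: "0 < \<rho>" and sep: "separated \<rho> m c" and m: "0 < m"
  shows "inj_on c {0..<1}"
proof -
  have ne: "c s \<noteq> c t" if "s < t" "t - s \<le> 1/2" for s t
  proof (cases "t - s \<le> \<rho>")
    case True
    then show ?thesis using nearly_straightD(3)[OF c, of "t - s" s] that by auto
  next
    case False
    then show ?thesis using sep[unfolded separated_def, rule_format, of t s] that m by auto
  qed
  have "c s \<noteq> c t" if "0 \<le> s" "s < t" "t < 1" for s t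
  proof (cases "t - s \<le> 1/2")
    case False
    then show ?thesis using ne[of t "s + 1"] that nearly_straightD(1)[OF c, of s 1] by simp
  qed (use ne that in auto)
  then show ?thesis by (intro linorder_inj_onI) auto
qed

text \<open>
  Compactness of the set of pairs at cyclic distance at least \<open>\<rho>\<close>.
\<close>

lemma separated_of_inj:
  fixes c :: "real \<Rightarrow> 'a::euclidean_space"
  assumes per: "\<And>x n. c (x + of_int n) = c x" and cont: "continuous_on UNIV c"
    and inj: "inj_on c {0..<1}" and \<rho>: "0 < \<rho>"
  obtains m where "0 < m" "separated \<rho> m c"
proof -
  let ?K = "{0..1::real} \<times> {\<rho>..1/2}"
  let ?f = "\<lambda>(s, l). norm (c (s + l) - c s)"
  have pos: "0 < ?f x" if "x \<in> ?K" for x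
  proof -
    obtain s l where x: "x = (s, l)" and s: "0 \<le> s" "s \<le> 1" and l: "0 < l" "l \<le> 1/2"
      using \<open>x \<in> ?K\<close> \<rho> by (cases x) auto
    have fr: "c y = c (frac y)" for y
      using per[of "frac y" "\<lfloor>y\<rfloor>"] by (simp add: frac_def)
    have "c (s + l) \<noteq> c s"
    proof
      assume "c (s + l) = c s"
      then have "frac (s + l) = frac s"
        using inj fr by (metis inj_onD atLeastLessThan_iff frac_ge_0 frac_lt_1)
      then have "l = of_int (\<lfloor>s + l\<rfloor> - \<lfloor>s\<rfloor>)" by (simp add: frac_def)
      then obtain k :: int where "l = of_int k" by blast
      then have "0 < k" "k < 1" using l by linarith+
      then show False by simp
    qed
    then show ?thesis by (simp add: x)
  qed
  have comp: "compact ?K" by (intro compact_Times) auto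
  have contf: "continuous_on ?K ?f"
    unfolding case_prod_beta
    by (intro continuous_intros continuous_on_compose2[OF cont]) auto
  have "\<exists>m>0. \<forall>x\<in>?K. m \<le> ?f x"
  proof (cases "?K = {}")
    case True
    then show ?thesis by (intro exI[of _ 1]) auto
  next
    case False
    obtain x where "x \<in> ?K" "\<forall>y\<in>?K. ?f x \<le> ?f y"
      using continuous_attains_inf[OF comp False contf] by blast
    then show ?thesis using pos by blast
  qed
  then obtain m where m: "0 < m" "\<And>x. x \<in> ?K \<Longrightarrow> m \<le> ?f x" by blast
  have "separated \<rho> m c"
    unfolding separated_def
  proof (intro allI impI)
    fix s t :: real assume st: "\<rho> \<le> t - s" "t - s \<le> 1/2"
    have "m \<le> norm (c (frac s + (t - s)) - c (frac s))"
      using m(2)[of "(frac s, t - s)"] st frac_lt_1[of s] by auto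
    also have "\<dots> = norm (c t - c s)"
    proof -
      have "frac s + (t - s) + of_int \<lfloor>s\<rfloor> = t" "frac s + of_int \<lfloor>s\<rfloor> = s" by (simp_all add: frac_def)
      then show ?thesis using per[of "frac s" "\<lfloor>s\<rfloor>"] per[of "frac s + (t - s)" "\<lfloor>s\<rfloor>"] by metis
    qed
    finally show "m \<le> norm (c t - c s)" .
  qed
  then show ?thesis using m(1) that by blast
qed

section \<open>Trigonometric test functions and approximate identities\<close>

text \<open>
  A class of smooth functions of period \<open>1\<close> that is visibly closed under differentiation, so that smoothness of
  test functions needs no computation of higher derivatives. The phase \<open>b\<close> makes sines and translates members.
\<close>

inductive_set trig_functions :: "(real \<Rightarrow> real) set" where
  trig_const: "(\<lambda>x. a) \<in> trig_functions"
| trig_cos: "(\<lambda>x. cos (2 * pi * x + b)) \<in> trig_functions"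
| trig_add: "f \<in> trig_functions \<Longrightarrow> g \<in> trig_functions \<Longrightarrow> (\<lambda>x. f x + g x) \<in> trig_functions"
| trig_mult: "f \<in> trig_functions \<Longrightarrow> g \<in> trig_functions \<Longrightarrow> (\<lambda>x. f x * g x) \<in> trig_functions"

lemma trig_power: "f \<in> trig_functions \<Longrightarrow> (\<lambda>x. f x ^ n) \<in> trig_functions"
proof (induction n)
  case 0 show ?case using trig_const[of 1] by simp
next
  case (Suc n)
  then show ?case using trig_mult[of f "\<lambda>x. f x ^ n"] by simp
qed

lemma trig_has_derivative:
  "f \<in> trig_functions \<Longrightarrow> \<exists>f'\<in>trig_functions. \<forall>x. (f has_real_derivative f' x) (at x)"
proof (induction rule: trig_functions.induct)
  case (trig_const a)
  show ?case by (intro bexI[of _ "\<lambda>x. 0"] trig_functions.trig_const) auto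
next
  case (trig_cos b)
  let ?f' = "\<lambda>x. (2 * pi) * cos (2 * pi * x + (b + pi / 2))"
  have "?f' \<in> trig_functions"
    by (rule trig_functions.trig_mult[OF trig_functions.trig_const trig_functions.trig_cos])
  moreover have "((\<lambda>x. cos (2 * pi * x + b)) has_real_derivative ?f' x) (at x)" for x
  proof -
    have "cos (2 * pi * x + (b + pi / 2)) = - sin (2 * pi * x + b)"
      using minus_sin_cos_eq[of "2 * pi * x + b"] by (simp add: add.assoc)
    then show ?thesis by (auto intro!: derivative_eq_intros)
  qed
  ultimately show ?case by (intro bexI[of _ ?f']) auto
next
  case (trig_add f g)
  then obtain f' g' where "f' \<in> trig_functions" "g' \<in> trig_functions"
    "\<And>x. (f has_real_derivative f' x) (at x)" "\<And>x. (g has_real_derivative g' x) (at x)" by blast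
  then show ?case
    by (intro bexI[of _ "\<lambda>x. f' x + g' x"] trig_functions.trig_add) (auto intro!: derivative_eq_intros)
next
  case (trig_mult f g)
  then obtain f' g' where "f' \<in> trig_functions" "g' \<in> trig_functions"
    "\<And>x. (f has_real_derivative f' x) (at x)" "\<And>x. (g has_real_derivative g' x) (at x)" by blast
  with trig_mult show ?case
    by (intro bexI[of _ "\<lambda>x. f' x * g x + g' x * f x"] trig_functions.intros)
      (auto intro!: derivative_eq_intros)
qed

lemma trig_smooth:
  "f \<in> trig_functions \<Longrightarrow> (deriv ^^ n) f field_differentiable at x"
proof (induction n arbitrary: f)
  case 0
  then show ?case using trig_has_derivative[of f] by (auto simp: field_differentiable_def)
next
  case (Suc n)
  obtain f' where f': "f' \<in> trig_functions" "\<And>x. (f has_real_derivative f' x) (at x)"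
    using trig_has_derivative[OF Suc.prems] by blast
  have "deriv f = f'" using f'(2) by (intro ext DERIV_imp_deriv)
  then show ?case using Suc.IH[OF f'(1)] by (simp add: funpow_swap1 del: funpow.simps add: funpow_Suc_right)
qed

text \<open>
  The function \<open>cos\<^sup>2\<^sup>n(\<pi> x)\<close>, which concentrates at the integers as \<open>n\<close> grows. As a trigonometric polynomial it
  spares the construction of smooth bump functions.
\<close>

definition cos_bump :: "nat \<Rightarrow> real \<Rightarrow> real" where
  "cos_bump n x = ((1 + cos (2 * pi * x)) / 2) ^ n"

definition peak :: "nat \<Rightarrow> real \<Rightarrow> real" where
  "peak n x = cos_bump n x / integral {0..1} (cos_bump n)"

lemma one_plus_cos_nonneg: "0 \<le> 1 + cos (x::real)"
  using cos_ge_minus_one[of x] by linarith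

lemma cos_bump_nonneg: "0 \<le> cos_bump n x"
  using one_plus_cos_nonneg[of "2 * pi * x"] by (simp add: cos_bump_def)

lemma continuous_on_cos_bump: "continuous_on A (cos_bump n)"
  unfolding cos_bump_def by (intro continuous_intros) auto

lemma cos_bump_integral_lower:
  assumes \<delta>: "0 < \<delta>" "\<delta> \<le> 1/2"
  shows "((1 + cos (pi * \<delta>)) / 2) ^ n * (\<delta> / 2) \<le> integral {0..1} (cos_bump n)"
proof -
  have ci: "cos_bump n integrable_on {a..b}" for a b
    by (intro integrable_continuous_interval continuous_on_cos_bump)
  have "((1 + cos (pi * \<delta>)) / 2) ^ n * (\<delta> / 2) = integral {0..\<delta>/2} (\<lambda>x. ((1 + cos (pi * \<delta>)) / 2) ^ n)"
    using \<delta> by simp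
  also have "\<dots> \<le> integral {0..\<delta>/2} (cos_bump n)"
  proof (intro integral_le ci)
    fix x assume x: "x \<in> {0..\<delta>/2}"
    have "pi * (2 * x) \<le> pi * \<delta>" using x by (intro mult_left_mono) auto
    moreover have "pi * \<delta> \<le> pi * 1" using \<delta> by (intro mult_left_mono) auto
    ultimately have "cos (pi * \<delta>) \<le> cos (2 * pi * x)"
      using x by (intro cos_monotone_0_pi_le) (auto simp: mult_ac)
    then show "((1 + cos (pi * \<delta>)) / 2) ^ n \<le> cos_bump n x"
      unfolding cos_bump_def using one_plus_cos_nonneg[of "pi * \<delta>"] by (intro power_mono) auto
  qed (auto intro: integrable_continuous_interval)
  also have "\<dots> \<le> integral {0..1} (cos_bump n)"
    using \<delta> by (intro integral_subset_le ci) (auto simp: cos_bump_nonneg)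
  finally show ?thesis .
qed

lemma cos_bump_integral_pos: "0 < integral {0..1} (cos_bump n)"
proof -
  have "0 < ((1 + cos (pi * (1/2))) / 2) ^ n * ((1/2) / 2 :: real)" by simp
  also have "\<dots> \<le> integral {0..1} (cos_bump n)" by (rule cos_bump_integral_lower) auto
  finally show ?thesis .
qed

lemma peak_nonneg: "0 \<le> peak n x"
  using cos_bump_nonneg[of n x] cos_bump_integral_pos[of n] by (simp add: peak_def)

lemma continuous_on_peak: "continuous_on A (peak n)"
  unfolding peak_def using continuous_on_cos_bump cos_bump_integral_pos[of n]
  by (intro continuous_intros) auto

lemma peak_minus: "peak n (- x) = peak n x"
  by (simp add: peak_def cos_bump_def)

lemma peak_trig: "(\<lambda>x. peak n (x - a)) \<in> trig_functions"
proof -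
  have "(\<lambda>x. 1/2 + 1/2 * cos (2 * pi * x + (- 2 * pi * a))) \<in> trig_functions"
    by (intro trig_functions.intros)
  from trig_power[OF this, of n]
  have "(\<lambda>x. (1 / integral {0..1} (cos_bump n)) * (1/2 + 1/2 * cos (2 * pi * x + (- 2 * pi * a))) ^ n) \<in> trig_functions"
    by (intro trig_functions.intros) simp
  moreover have "(1 / integral {0..1} (cos_bump n)) * (1/2 + 1/2 * cos (2 * pi * x + (- 2 * pi * a))) ^ n
     = peak n (x - a)" for x
    by (simp add: peak_def cos_bump_def algebra_simps add_divide_distrib)
  ultimately show ?thesis by simp
qed

text \<open>
  The primitive \<open>Q\<close> increases by exactly \<open>1\<close> over each period, so that differences
  \<open>Q(b - x) - Q(a - x)\<close> are periodic and can serve as test functions.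
\<close>

lemma peak_antiderivative:
  "\<exists>Q. (\<forall>x. (Q has_real_derivative peak n x) (at x)) \<and> (\<forall>x. Q (x + 1) = Q x + 1)"
proof -
  have "\<exists>Q. \<forall>x::real. -\<infinity> < ereal x \<longrightarrow> ereal x < \<infinity> \<longrightarrow> (Q has_vector_derivative peak n x) (at x)"
    using continuous_on_peak[of UNIV n]
    by (intro einterval_antiderivative) (auto simp: continuous_on_eq_continuous_at)
  then obtain Q where Q: "\<And>x. (Q has_real_derivative peak n x) (at x)"
    by (auto simp: has_real_derivative_iff_has_vector_derivative)
  have per: "peak n (x + 1) = peak n x" for x
    by (simp add: peak_def cos_bump_def distrib_left)
  have "((\<lambda>x. Q (x + 1) - Q x) has_real_derivative 0) (at x)" for x
  proof -
    have "((\<lambda>x. Q (x + 1)) has_real_derivative peak n (x + 1)) (at x)"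
      using Q[of "x + 1"] by (simp add: DERIV_shift)
    from DERIV_diff[OF this Q[of x]] show ?thesis using per by simp
  qed
  then have const: "Q (x + 1) - Q x = Q (0 + 1) - Q 0" for x
    using DERIV_isconst_all[of "\<lambda>x. Q (x + 1) - Q x" x 0] by simp
  have "(peak n has_integral (Q 1 - Q 0)) {0..1}"
    using Q by (intro fundamental_theorem_of_calculus)
      (auto simp: has_real_derivative_iff_has_vector_derivative[symmetric] intro: has_field_derivative_at_within)
  moreover have "(peak n has_integral 1) {0..1}"
  proof -
    have "(cos_bump n has_integral integral {0..1} (cos_bump n)) {0..1}"
      by (intro integrable_integral integrable_continuous_interval continuous_on_cos_bump)
    from has_integral_divide[OF this, of "integral {0..1} (cos_bump n)"]
    show ?thesis using cos_bump_integral_pos[of n] by (simp add: peak_def[abs_def])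
  qed
  ultimately have "Q 1 - Q 0 = 1" by (rule has_integral_unique)
  then have "Q (x + 1) = Q x + 1" for x using const[of x] by simp
  with Q show ?thesis by (intro exI[of _ Q] conjI allI)
qed

lemma peak_has_integral:
  assumes Q: "\<And>x. (Q has_real_derivative peak n x) (at x)" and ab: "a \<le> b"
  shows "((\<lambda>t. peak n (t - x)) has_integral (Q (b - x) - Q (a - x))) {a..b}"
proof -
  have "((\<lambda>t. Q (t - x)) has_real_derivative peak n (t - x)) (at t)" for t
    using DERIV_shift[THEN iffD1, of Q "peak n (t - x)" t "- x"] Q by simp
  then show ?thesis
    using ab by (intro fundamental_theorem_of_calculus)
      (auto simp: has_real_derivative_iff_has_vector_derivative[symmetric] intro: has_field_derivative_at_within)
qed

text \<open>
  Outside a neighbourhood of the integers the bump is at most \<open>q2\<^sup>n\<close>, while its integral is at least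
  of order \<open>q1\<^sup>n\<close> for some \<open>q1 > q2\<close>, the value of the base at half the distance.
\<close>

lemma peak_small_away:
  assumes \<delta>: "0 < \<delta>" "\<delta> < 1/2"
  obtains \<eta> where "\<eta> \<longlonglongrightarrow> 0" "\<And>n. 0 \<le> \<eta> n" "\<And>n y. \<delta> \<le> \<bar>y\<bar> \<Longrightarrow> \<bar>y\<bar> \<le> 1 - \<delta> \<Longrightarrow> peak n y \<le> \<eta> n"
proof -
  define q1 q2 where "q1 = (1 + cos (pi * \<delta>)) / 2" and "q2 = (1 + cos (2 * pi * \<delta>)) / 2"
  have pd: "0 < pi * \<delta>" "2 * pi * \<delta> < pi" using \<delta> by auto
  have "cos (2 * pi * \<delta>) < cos (pi * \<delta>)"
    using pd \<delta> by (intro cos_monotone_0_pi) auto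
  then have q: "q2 < q1" "0 \<le> q2" using one_plus_cos_nonneg[of "2 * pi * \<delta>"]
    by (simp_all add: q1_def q2_def)
  define \<eta> where "\<eta> n = (q2 / q1) ^ n * (2 / \<delta>)" for n
  have "0 \<le> q2 / q1" "q2 / q1 < 1" using q by (simp_all add: divide_less_eq)
  then have "(\<lambda>n. (q2 / q1) ^ n) \<longlonglongrightarrow> 0" by (rule LIMSEQ_realpow_zero)
  then have "\<eta> \<longlonglongrightarrow> 0 * (2 / \<delta>)"
    unfolding \<eta>_def by (rule tendsto_mult[OF _ tendsto_const])
  moreover have "peak n y \<le> \<eta> n" if y: "\<delta> \<le> \<bar>y\<bar>" "\<bar>y\<bar> \<le> 1 - \<delta>" for n y
  proof -
    \<comment> \<open>The distance of \<open>y\<close> to the nearest integer.\<close>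
    define z where "z = (if \<bar>y\<bar> \<le> 1/2 then \<bar>y\<bar> else 1 - \<bar>y\<bar>)"
    have z: "\<delta> \<le> z" "z \<le> 1/2" using y by (auto simp: z_def)
    have "cos (2 * pi * y) = cos (2 * pi * \<bar>y\<bar>)" by (cases "0 \<le> y") auto
    also have "\<dots> = cos (2 * pi * z)"
      by (simp add: z_def right_diff_distrib cos_diff)
    also have "\<dots> \<le> cos (2 * pi * \<delta>)"
      using z \<delta> by (intro cos_monotone_0_pi_le) auto
    finally have "cos_bump n y \<le> q2 ^ n"
      unfolding cos_bump_def q2_def using one_plus_cos_nonneg[of "2 * pi * y"] by (intro power_mono) auto
    then have "peak n y \<le> q2 ^ n / (q1 ^ n * (\<delta> / 2))"
      unfolding peak_def using cos_bump_integral_lower[of \<delta> n] \<delta> q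
      by (intro frac_le) (auto simp: q1_def[symmetric])
    then show ?thesis by (simp add: \<eta>_def power_divide)
  qed
  moreover have "0 \<le> \<eta> n" for n using q \<delta> by (simp add: \<eta>_def)
  ultimately show ?thesis by (intro that[of \<eta>]) auto
qed

abbreviation unit_interval :: "real measure" where
  "unit_interval \<equiv> lebesgue_on {0..1}"

lemma measurable_unit_interval_continuous:
  "continuous_on {0..1} f \<Longrightarrow> f \<in> borel_measurable unit_interval"
  by (intro continuous_imp_measurable_on_sets_lebesgue) auto

text \<open>
  The mass of the peak concentrates at \<open>x\<close>, where \<open>u\<close> is nearly constant. The kernel is periodic, but for \<open>x\<close> inside
  the unit interval and small \<open>\<delta>\<close> every \<open>t\<close> in it with \<open>|t - x| \<ge> \<delta>\<close> satisfies \<open>|t - x| \<le> 1 - \<delta>\<close> and so avoids the peaks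
  at \<open>x \<plusminus> 1\<close>.
\<close>

lemma peak_approximate_identity:
  fixes u :: "real \<Rightarrow> 'a::euclidean_space"
  assumes u: "u \<in> borel_measurable unit_interval" and M: "\<And>t. t \<in> {0..1} \<Longrightarrow> norm (u t) \<le> M"
    and x: "0 < x" "x < 1" and cont: "isCont u x"
  shows "(\<lambda>n. LINT t|unit_interval. peak n (t - x) *\<^sub>R u t) \<longlonglongrightarrow> u x"
proof (rule LIMSEQ_I)
  fix \<epsilon> :: real assume \<epsilon>: "0 < \<epsilon>"
  have M0: "0 \<le> M" using order_trans[OF norm_ge_zero M[of 0]] by simp
  obtain d where d: "0 < d" "\<And>t. \<bar>t - x\<bar> < d \<Longrightarrow> norm (u t - u x) < \<epsilon> / 2"
    using cont \<epsilon> unfolding continuous_at_eps_delta dist_norm real_norm_def by (meson half_gt_zero)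
  define \<delta> where "\<delta> = Min {d, x, 1 - x, 1/4}"
  have \<delta>: "0 < \<delta>" "\<delta> < 1/2" "\<delta> \<le> x" "\<delta> \<le> 1 - x" "\<delta> \<le> d"
    using d x by (auto simp: \<delta>_def min_def)
  obtain \<eta> where \<eta>: "\<eta> \<longlonglongrightarrow> 0" "\<And>n. 0 \<le> \<eta> n" "\<And>n y. \<delta> \<le> \<bar>y\<bar> \<Longrightarrow> \<bar>y\<bar> \<le> 1 - \<delta> \<Longrightarrow> peak n y \<le> \<eta> n"
    using peak_small_away[OF \<delta>(1,2)] by blast
  have "(\<lambda>n. 2 * M * \<eta> n) \<longlonglongrightarrow> 2 * M * 0" using \<eta>(1) by (intro tendsto_intros)
  then have ev: "\<forall>\<^sub>F n in sequentially. 2 * M * \<eta> n < \<epsilon> / 2"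
    using \<epsilon> by (intro order_tendstoD(2)) auto
  have ux: "norm (u x) \<le> M" using M x by auto
  have pint: "integrable unit_interval (\<lambda>t. peak n (t - x))" and
    pone: "(LINT t|unit_interval. peak n (t - x)) = 1" for n
  proof -
    have pc: "continuous_on {0..1} (\<lambda>t. peak n (t - x))"
      by (intro continuous_on_compose2[OF continuous_on_peak[of UNIV]] continuous_intros) auto
    then show i: "integrable unit_interval (\<lambda>t. peak n (t - x))"
      by (rule continuous_imp_integrable_real)
    from peak_antiderivative[of n] obtain Q
      where "(\<forall>x. (Q has_real_derivative peak n x) (at x)) \<and> (\<forall>x. Q (x + 1) = Q x + 1)" ..
    then have Q: "\<And>x. (Q has_real_derivative peak n x) (at x)" "\<And>x. Q (x + 1) = Q x + 1"
      by blast+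
    have "integral {0..1} (\<lambda>t. peak n (t - x)) = 1"
      using integral_unique[OF peak_has_integral[OF Q(1), of 0 1 x]] Q(2)[of "- x"] by simp
    then show "(LINT t|unit_interval. peak n (t - x)) = 1"
      using lebesgue_integral_eq_integral[OF i] by simp
  qed
  have bound: "norm ((LINT t|unit_interval. peak n (t - x) *\<^sub>R u t) - u x) \<le> \<epsilon> / 2 + 2 * M * \<eta> n" for n
  proof -
    have int: "integrable unit_interval (\<lambda>t. peak n (t - x) *\<^sub>R u t)"
    proof (rule Bochner_Integration.integrable_bound)
      show "integrable unit_interval (\<lambda>t. M * peak n (t - x))" using pint by auto
      show "(\<lambda>t. peak n (t - x) *\<^sub>R u t) \<in> borel_measurable unit_interval"
        using borel_measurable_integrable[OF pint] u by measurable
      show "AE t in unit_interval. norm (peak n (t - x) *\<^sub>R u t) \<le> norm (M * peak n (t - x))"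
        using M M0 peak_nonneg by (intro AE_I2) (auto simp: abs_mult mult.commute intro!: mult_right_mono)
    qed
    have "(LINT t|unit_interval. peak n (t - x) *\<^sub>R u t) - u x =
        (LINT t|unit_interval. peak n (t - x) *\<^sub>R u t) - (LINT t|unit_interval. peak n (t - x) *\<^sub>R u x)"
      using pint by (simp add: pone)
    also have "\<dots> = (LINT t|unit_interval. peak n (t - x) *\<^sub>R u t - peak n (t - x) *\<^sub>R u x)"
      using int pint by (intro Bochner_Integration.integral_diff[symmetric]) auto
    finally have eq: "(LINT t|unit_interval. peak n (t - x) *\<^sub>R u t) - u x =
      (LINT t|unit_interval. peak n (t - x) *\<^sub>R u t - peak n (t - x) *\<^sub>R u x)" .
    have le: "norm (peak n (t - x) *\<^sub>R u t - peak n (t - x) *\<^sub>R u x) \<le> \<epsilon>/2 * peak n (t - x) + 2 * M * \<eta> n"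
      if t: "t \<in> {0..1}" for t
    proof (cases "\<bar>t - x\<bar> < \<delta>")
      case True
      then have "norm (u t - u x) \<le> \<epsilon> / 2" using d(2)[of t] \<delta>(5) by auto
      then have "peak n (t - x) * norm (u t - u x) \<le> peak n (t - x) * (\<epsilon> / 2)"
        by (intro mult_left_mono peak_nonneg)
      moreover have "0 \<le> 2 * M * \<eta> n" using M0 \<eta>(2)[of n] by simp
      ultimately show ?thesis
        unfolding scaleR_diff_right[symmetric] norm_scaleR abs_of_nonneg[OF peak_nonneg]
        by (simp add: mult.commute[of \<epsilon>])
    next
      case False
      have "norm (u t - u x) \<le> 2 * M"
        using norm_triangle_ineq4[of "u t" "u x"] M[OF t] ux by linarith
      moreover have "peak n (t - x) \<le> \<eta> n"
        using False t x \<delta> by (intro \<eta>(3)) auto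
      ultimately have "peak n (t - x) * norm (u t - u x) \<le> \<eta> n * (2 * M)"
        using peak_nonneg[of n "t - x"] \<eta>(2)[of n] by (intro mult_mono) auto
      moreover have "0 \<le> \<epsilon>/2 * peak n (t - x)" using \<epsilon> peak_nonneg[of n "t - x"] by simp
      ultimately show ?thesis
        using peak_nonneg[of n "t - x"] by (simp add: mult_ac flip: scaleR_diff_right)
    qed
    have one: "measure unit_interval {0..1} = 1"
      by (subst measure_restrict_space) auto
    interpret finite_measure unit_interval
      by (rule finite_measure_lebesgue_on) auto
    have "norm (LINT t|unit_interval. peak n (t - x) *\<^sub>R u t - peak n (t - x) *\<^sub>R u x)
        \<le> (LINT t|unit_interval. \<epsilon>/2 * peak n (t - x) + 2 * M * \<eta> n)"
      using pint int le by (intro Bochner_Integration.integral_norm_bound_integral) auto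
    also have "\<dots> = \<epsilon>/2 + 2 * M * \<eta> n"
      using pint one by (simp add: pone)
    finally show ?thesis unfolding eq .
  qed
  show "\<exists>no. \<forall>n\<ge>no. norm ((LINT t|unit_interval. peak n (t - x) *\<^sub>R u t) - u x) < \<epsilon>"
  proof -
    obtain N where "\<And>n. n \<ge> N \<Longrightarrow> 2 * M * \<eta> n < \<epsilon> / 2"
      using ev unfolding eventually_sequentially by blast
    then have "norm ((LINT t|unit_interval. peak n (t - x) *\<^sub>R u t) - u x) < \<epsilon>" if "n \<ge> N" for n
      using bound[of n] that by (smt (verit, best) field_sum_of_halves)
    then show ?thesis by blast
  qed
qed

section \<open>Continuous functions are primitives of their weak derivatives\<close>

text \<open>
  The test function is the smoothed indicator \<open>\<Phi> n = peak n * 1\<^bsub>[a,b]\<^esub>\<close> (convolution), whose derivative is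
  \<open>peak n (x - a) - peak n (x - b)\<close>. In the limit the weak derivative identity becomes
  \<open>f a - f b = - \<integral> 1\<^bsub>[a,b]\<^esub> g\<close>: the left side by the approximate identity, the right side by dominated convergence.
\<close>

lemma weak_deriv_integral_interior:
  fixes f g :: "real \<Rightarrow> 'a::euclidean_space"
  assumes f: "continuous_on UNIV f" and g: "integrable unit_interval g"
    and w: "has_weak_deriv f g" and ab: "0 < a" "a < b" "b < 1"
  shows "f b - f a = integral {a..b} g"
proof -
  from choice[OF allI[OF peak_antiderivative]] obtain Q
    where "\<forall>n. (\<forall>x. (Q n has_real_derivative peak n x) (at x)) \<and> (\<forall>x. Q n (x + 1) = Q n x + 1)" ..
  then have Q: "\<And>n x. (Q n has_real_derivative peak n x) (at x)"
      and Qper: "\<And>n x. Q n (x + 1) = Q n x + 1"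
    by blast+
  have Qper': "Q n (x - 1) = Q n x - 1" for n x using Qper[of n "x - 1"] by simp
  have Qmono: "Q n x \<le> Q n y" if "x \<le> y" for n x y
    using that Q peak_nonneg by (intro DERIV_nonneg_imp_nondecreasing[of x y "Q n"]) blast+
  define \<Phi> where "\<Phi> n t = Q n (b - t) - Q n (a - t)" for n t
  have D\<Phi>: "(\<Phi> n has_real_derivative peak n (t - a) - peak n (t - b)) (at t)" for n t
  proof -
    have "((\<lambda>t. Q n (c - t)) has_real_derivative - peak n (t - c)) (at t)" for c
    proof -
      have "((\<lambda>t. c - t) has_real_derivative - 1) (at t)" by (auto intro!: derivative_eq_intros)
      from DERIV_chain2[OF Q this, of n] show ?thesis
        using peak_minus[of n "t - c"] by simp
    qed
    from DERIV_diff[OF this[of b] this[of a]] show ?thesis by (simp add: \<Phi>_def[abs_def])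
  qed
  have smooth: "smooth_periodic (\<Phi> n)" for n
    unfolding smooth_periodic_def
  proof (intro conjI allI)
    show "periodic_fun_simple' (\<Phi> n)"
    proof
      fix x
      have "b - (x + 1) = (b - x) - 1" "a - (x + 1) = (a - x) - 1" by simp_all
      then show "\<Phi> n (x + 1) = \<Phi> n x" unfolding \<Phi>_def by (simp only: Qper')
    qed
    fix k x
    have d: "deriv (\<Phi> n) = (\<lambda>t. peak n (t - a) + (- 1) * peak n (t - b))"
      using D\<Phi> by (intro ext DERIV_imp_deriv) simp
    show "(deriv ^^ k) (\<Phi> n) field_differentiable at x"
    proof (cases k)
      case 0
      then show ?thesis using D\<Phi> by (auto simp: field_differentiable_def)
    next
      case (Suc j)
      have "deriv (\<Phi> n) \<in> trig_functions"
        unfolding d by (intro trig_functions.intros peak_trig)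
      then show ?thesis
        using trig_smooth by (simp add: Suc funpow_swap1 del: funpow.simps add: funpow_Suc_right)
    qed
  qed
  have pf: "integrable unit_interval (\<lambda>x. peak n (x - c) *\<^sub>R f x)" for n c
    by (intro continuous_imp_integrable_real continuous_intros continuous_on_compose2[OF f]
        continuous_on_compose2[OF continuous_on_peak[of UNIV]]) auto
  obtain M where M: "\<And>t. t \<in> {0..1} \<Longrightarrow> norm (f t) \<le> M"
  proof -
    have "compact (f ` {0..1})"
      using f by (intro compact_continuous_image) (auto intro: continuous_on_subset)
    then obtain M where "\<forall>y\<in>f ` {0..1}. norm y \<le> M"
      using compact_imp_bounded bounded_iff by blast
    then show ?thesis by (intro that[of M]) blast
  qed
  have pl: "(\<lambda>n. LINT x|unit_interval. peak n (x - c) *\<^sub>R f x) \<longlonglongrightarrow> f c" if "0 < c" "c < 1" for c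
    using that M continuous_on_subset[OF f] f[unfolded continuous_on_eq_continuous_at[OF open_UNIV]]
    by (intro peak_approximate_identity[where M = M] measurable_unit_interval_continuous) auto
  have "(\<lambda>n. (LINT x|unit_interval. peak n (x - a) *\<^sub>R f x) - (LINT x|unit_interval. peak n (x - b) *\<^sub>R f x))
      \<longlonglongrightarrow> f a - f b"
    using ab by (intro tendsto_diff pl) auto
  moreover have "(LINT x|unit_interval. peak n (x - a) *\<^sub>R f x) - (LINT x|unit_interval. peak n (x - b) *\<^sub>R f x)
      = - (LINT x|unit_interval. \<Phi> n x *\<^sub>R g x)" for n
  proof -
    have "deriv (\<Phi> n) = (\<lambda>t. peak n (t - a) - peak n (t - b))"
      using D\<Phi> by (intro ext DERIV_imp_deriv)
    then have "(LINT x|unit_interval. (peak n (x - a) - peak n (x - b)) *\<^sub>R f x) = - (LINT x|unit_interval. \<Phi> n x *\<^sub>R g x)"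
      using w[unfolded has_weak_deriv_def, rule_format, OF smooth[of n]] by simp
    then show ?thesis
      using pf by (simp add: scaleR_diff_left Bochner_Integration.integral_diff)
  qed
  ultimately have lim1: "(\<lambda>n. - (LINT x|unit_interval. \<Phi> n x *\<^sub>R g x)) \<longlonglongrightarrow> f a - f b" by simp
  have ind: "indicat_real {a..b} \<in> borel_measurable unit_interval"
    by (intro measurable_restrict_space1 borel_measurable_indicator) auto
  have \<Phi>lim: "(\<lambda>n. \<Phi> n x) \<longlonglongrightarrow> indicator {a..b} x" if x: "0 < x" "x < 1" "x \<noteq> a" "x \<noteq> b" for x
  proof -
    have "(\<lambda>n. LINT t|unit_interval. peak n (t - x) *\<^sub>R indicat_real {a..b} t) \<longlonglongrightarrow> indicator {a..b} x"
    proof (rule peak_approximate_identity[where M = 1])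
      show "isCont (indicat_real {a..b}) x"
        using x by (intro isCont_indicator[THEN iffD2]) (auto simp: frontier_def)
    qed (use x ind in \<open>auto intro: indicator_le_1\<close>)
    moreover have "(LINT t|unit_interval. peak n (t - x) *\<^sub>R indicat_real {a..b} t) = \<Phi> n x" for n
    proof -
      have "(LINT t|unit_interval. peak n (t - x) *\<^sub>R indicat_real {a..b} t) =
          (LINT t|unit_interval. (if t \<in> {a..b} then peak n (t - x) else 0))"
        by (intro Bochner_Integration.integral_cong) (auto simp: indicator_def)
      also have "\<dots> = (LINT t|lebesgue_on {a..b}. peak n (t - x))"
        using ab by (intro Lebesgue_Measure.integral_restrict) auto
      also have "\<dots> = integral {a..b} (\<lambda>t. peak n (t - x))"
        by (intro lebesgue_integral_eq_integral continuous_imp_integrable_real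
            continuous_on_compose2[OF continuous_on_peak[of UNIV]] continuous_intros) auto
      also have "\<dots> = \<Phi> n x"
        unfolding \<Phi>_def using ab by (intro integral_unique peak_has_integral Q) auto
      finally show ?thesis .
    qed
    ultimately show ?thesis by simp
  qed
  have \<Phi>bd: "\<bar>\<Phi> n x\<bar> \<le> 1" if "x \<in> {0..1}" for n x
    using Qmono[of "a - x" "b - x" n] Qmono[of "b - x" "1 - x" n] Qmono[of "0 - x" "a - x" n]
      Qper[of n "0 - x"] ab by (simp add: \<Phi>_def)
  have \<Phi>cont: "continuous_on A (\<Phi> n)" for A n
    using D\<Phi> by (meson DERIV_isCont continuous_at_imp_continuous_on)
  have ae: "AE x in unit_interval. x \<noteq> c" for c :: real
    using AE_completion[OF AE_lborel_singleton[of c]]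
    by (subst AE_restrict_space_iff) (auto elim: eventually_mono)
  have "(\<lambda>n. LINT x|unit_interval. \<Phi> n x *\<^sub>R g x) \<longlonglongrightarrow> (LINT x|unit_interval. indicator {a..b} x *\<^sub>R g x)"
  proof (rule integral_dominated_convergence)
    show "(\<lambda>x. indicat_real {a..b} x *\<^sub>R g x) \<in> borel_measurable unit_interval"
      using borel_measurable_integrable[OF g] by (intro borel_measurable_scaleR ind)
    show "(\<lambda>x. \<Phi> n x *\<^sub>R g x) \<in> borel_measurable unit_interval" for n
      by (rule borel_measurable_scaleR[OF measurable_unit_interval_continuous[OF \<Phi>cont]
            borel_measurable_integrable[OF g]])
    show "integrable unit_interval (\<lambda>x. norm (g x))" using g by auto
    show "AE x in unit_interval. norm (\<Phi> n x *\<^sub>R g x) \<le> norm (g x)" for n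
      using \<Phi>bd by (intro AE_I2) (auto intro!: mult_left_le_one_le)
    show "AE x in unit_interval. (\<lambda>n. \<Phi> n x *\<^sub>R g x) \<longlonglongrightarrow> indicat_real {a..b} x *\<^sub>R g x"
      using ae[of 0] ae[of 1] ae[of a] ae[of b] AE_space
    proof eventually_elim
      case (elim x)
      then show ?case by (intro tendsto_scaleR \<Phi>lim tendsto_const) auto
    qed
  qed
  then have "(\<lambda>n. - (LINT x|unit_interval. \<Phi> n x *\<^sub>R g x)) \<longlonglongrightarrow> - (LINT x|unit_interval. indicator {a..b} x *\<^sub>R g x)"
    by (rule tendsto_minus)
  from LIMSEQ_unique[OF lim1 this]
  have "f b - f a = (LINT x|unit_interval. indicator {a..b} x *\<^sub>R g x)"
    by (simp add: algebra_simps)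
  also have "\<dots> = (LINT x|unit_interval. (if x \<in> {a..b} then g x else 0))"
    by (intro Bochner_Integration.integral_cong) (auto simp: indicator_def)
  also have "\<dots> = (LINT x|lebesgue_on {a..b}. g x)"
    using ab by (intro Lebesgue_Measure.integral_restrict) auto
  also have "\<dots> = integral {a..b} g"
  proof (rule lebesgue_integral_eq_integral)
    show "integrable (lebesgue_on {a..b}) g"
      using ab g by (intro integrable_subinterval[of 0 1 g a b]) auto
  qed auto
  finally show ?thesis .
qed

text \<open>
  The endpoints \<open>0\<close> and \<open>1\<close> are reached by continuity of \<open>f\<close> and of the primitive of \<open>g\<close>.
\<close>

lemma weak_deriv_has_integral:
  fixes f g :: "real \<Rightarrow> 'a::euclidean_space"
  assumes f: "continuous_on UNIV f" and g: "integrable unit_interval g"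
    and w: "has_weak_deriv f g" and ab: "0 \<le> a" "a \<le> b" "b \<le> 1"
  shows "(g has_integral (f b - f a)) {a..b}"
proof -
  have gi: "g integrable_on {0..1}"
    using has_integral_integral_lebesgue_on[OF g] by auto
  have gs: "g integrable_on {x..y}" if "0 \<le> x" "y \<le> 1" for x y
    using gi that by (auto intro: integrable_subinterval_real)
  define G where "G x = integral {0..x} g" for x
  have G: "G y - G x = integral {x..y} g" if "0 \<le> x" "x \<le> y" "y \<le> 1" for x y
    using Henstock_Kurzweil_Integration.integral_combine[OF that(1,2) gs] that
    by (simp add: G_def algebra_simps)
  have cont: "continuous_on {0..1} (\<lambda>x. f x - G x)"
    unfolding G_def
    using f by (intro continuous_on_diff indefinite_integral_continuous_1 gi) (auto intro: continuous_on_subset)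
  have const: "f x - G x = f (1/2) - G (1/2)" if "x \<in> {0..1}" for x
  proof (rule continuous_constant_on_closure[of "{0<..<1}"])
    show "f x - G x = f (1/2) - G (1/2)" if "x \<in> {0<..<1}" for x :: real
    proof (cases x "1/2 :: real" rule: linorder_cases)
      case less
      then show ?thesis
        using weak_deriv_integral_interior[OF f g w, of x "1/2"] G[of x "1/2"] that
        by (simp add: algebra_simps)
    next
      case greater
      then show ?thesis
        using weak_deriv_integral_interior[OF f g w, of "1/2" x] G[of "1/2" x] that
        by (simp add: algebra_simps)
    next
      case equal
      then show ?thesis by (simp only:)
    qed
  qed (use cont that in auto)
  have "f b - f a = G b - G a"
  proof -
    have "f a - G a = f b - G b"
      using const[of a] const[of b] ab by simp
    then show ?thesis by (simp add: algebra_simps)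
  qed
  also have "\<dots> = integral {a..b} g" using G ab by auto
  finally show ?thesis
    using gs[of a b] ab by (simp add: integrable_integral)
qed

section \<open>Periodic Borel representatives and their uniqueness\<close>

lemma nn_integral_lebesgue_on:
  assumes "A \<in> sets borel"
  shows "(\<integral>\<^sup>+x. f x \<partial>lebesgue_on A) = (\<integral>\<^sup>+x. f x * indicator A x \<partial>lborel)"
  using assms by (simp add: nn_integral_restrict_space nn_integral_completion)

lemma nn_integral_lebesgue_on_subset:
  assumes "A \<in> sets borel" "B \<in> sets borel" "A \<subseteq> B"
  shows "(\<integral>\<^sup>+x. f x \<partial>lebesgue_on A) \<le> (\<integral>\<^sup>+x. f x \<partial>lebesgue_on B)"
  unfolding nn_integral_lebesgue_on[OF assms(1)] nn_integral_lebesgue_on[OF assms(2)]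
  using assms(3) by (intro nn_integral_mono) (auto simp: indicator_def)

text \<open>
  Integrals of periodic functions over any interval of length one agree, here for windows that start in the unit
  interval. It transfers statements about the unit interval to arcs across the base point.
\<close>

lemma nn_integral_period_shift:
  fixes F :: "real \<Rightarrow> ennreal"
  assumes F[measurable]: "F \<in> borel_measurable borel" and per: "\<And>x. F (x + 1) = F x"
    and c: "0 \<le> c" "c \<le> 1"
  shows "(\<integral>\<^sup>+x. F x \<partial>lebesgue_on {c..c+1}) = (\<integral>\<^sup>+x. F x \<partial>lebesgue_on {0..1})"
proof -
  have half_open: "(\<integral>\<^sup>+x. F x * indicator {a..b} x \<partial>lborel) =
      (\<integral>\<^sup>+x. F x * indicator {a..<m} x \<partial>lborel) + (\<integral>\<^sup>+x. F x * indicator {m..<b} x \<partial>lborel)"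
    if "a \<le> m" "m \<le> b" for a m b :: real
  proof -
    have "(\<integral>\<^sup>+x. F x * indicator {a..b} x \<partial>lborel) =
        (\<integral>\<^sup>+x. F x * indicator {a..<m} x + F x * indicator {m..<b} x \<partial>lborel)"
      using that
      by (intro nn_integral_cong_AE eventually_mono[OF AE_lborel_singleton[of b]])
        (auto simp: indicator_def)
    then show ?thesis by (simp add: nn_integral_add)
  qed
  have "(\<integral>\<^sup>+x. F x * indicator {1..<c+1} x \<partial>lborel) =
      (\<integral>\<^sup>+x. F (1 + 1 * x) * indicator {1..<c+1} (1 + 1 * x) \<partial>lborel)"
    by (subst nn_integral_real_affine[where c = 1 and t = 1]) auto
  also have "\<dots> = (\<integral>\<^sup>+x. F x * indicator {0..<c} x \<partial>lborel)"
    using per by (intro nn_integral_cong) (auto simp: indicator_def add.commute)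
  finally show ?thesis
    using half_open[of c 1 "c + 1"] half_open[of 0 c 1] c
    by (simp add: nn_integral_lebesgue_on add.commute)
qed

text \<open>
  Weak derivatives are only Lebesgue measurable and only determined up to null sets. A periodic Borel
  representative makes the translation of integrals and the measurability of iterated integrals available.
\<close>

definition borel_version :: "(real \<Rightarrow> 'a::euclidean_space) \<Rightarrow> (real \<Rightarrow> 'a) \<Rightarrow> bool" where
  "borel_version w g \<longleftrightarrow> g \<in> borel_measurable borel \<and> (\<forall>x n. g (x + of_int n) = g x) \<and>
     (AE x in unit_interval. w x = g x)"

lemma AE_lebesgue_on_interval_iff:
  "(AE x in lebesgue_on {a..b::real}. P x) \<longleftrightarrow> (AE x in lebesgue. x \<in> {a..b} \<longrightarrow> P x)"
  by (subst AE_restrict_space_iff) auto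

lemma borel_version_exists:
  fixes w :: "real \<Rightarrow> 'a::euclidean_space"
  assumes w: "w \<in> borel_measurable unit_interval"
  shows "\<exists>g. borel_version w g"
proof -
  have "\<exists>h. h \<in> borel_measurable borel \<and> (AE x in lborel. (if x \<in> {0..1} then w x \<bullet> b else 0) = h x)" for b
  proof -
    have "(\<lambda>x. if x \<in> {0..1} then w x \<bullet> b else 0) \<in> borel_measurable lebesgue"
      using w by (subst borel_measurable_if) auto
    from completion_ex_borel_measurable_real[OF this] obtain h
      where "h \<in> borel_measurable lborel" "AE x in lborel. (if x \<in> {0..1} then w x \<bullet> b else 0) = h x" ..
    then show ?thesis by (intro exI[of _ h] conjI) simp_all
  qed
  from choice[OF allI[OF this]] obtain h
    where "\<forall>b. h b \<in> borel_measurable borel \<and> (AE x in lborel. (if x \<in> {0..1} then w x \<bullet> b else 0) = h b x)" ..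
  then have h[measurable]: "\<And>b. h b \<in> borel_measurable borel"
    and hw: "\<And>b. AE x in lborel. (if x \<in> {0..1} then w x \<bullet> b else 0) = h b x" by blast+
  define g where "g x = (\<Sum>b\<in>Basis. h b (frac x) *\<^sub>R b)" for x
  have fr[measurable]: "(frac :: real \<Rightarrow> real) \<in> borel_measurable borel"
    unfolding frac_def by measurable
  have "AE x in lborel. \<forall>b\<in>Basis. (if x \<in> {0..1} then w x \<bullet> b else 0) = h b x"
    by (intro AE_finite_allI hw) simp
  with AE_lborel_singleton[of 1] have "AE x in lborel. x \<in> {0..1} \<longrightarrow> w x = g x"
  proof eventually_elim
    case (elim x)
    show ?case
    proof
      assume x: "x \<in> {0..1}"
      then have "frac x = x" using elim(1) by (intro frac_eq[THEN iffD2]) auto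
      then have "g x = (\<Sum>b\<in>Basis. (w x \<bullet> b) *\<^sub>R b)"
        unfolding g_def using elim(2) x by (intro sum.cong) auto
      then show "w x = g x" by (simp add: euclidean_representation)
    qed
  qed
  then have "AE x in unit_interval. w x = g x"
    unfolding AE_lebesgue_on_interval_iff by (rule AE_completion)
  moreover have "g \<in> borel_measurable borel"
    unfolding g_def by measurable
  moreover have "g (x + of_int n) = g x" for x n by (simp add: g_def)
  ultimately show ?thesis by (auto simp: borel_version_def)
qed

text \<open>
  The intervals generate the Borel sets, so all integrals of \<open>h\<close> over Borel sets vanish, and \<open>h\<close> is the
  density of the zero measure. This yields uniqueness of weak derivatives.
\<close>

lemma AE_zero_of_interval_integrals:
  fixes h :: "real \<Rightarrow> 'a::euclidean_space"
  assumes h: "integrable unit_interval h" and hb: "h \<in> borel_measurable borel"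
    and zero: "\<And>a. 0 \<le> a \<Longrightarrow> a \<le> 1 \<Longrightarrow> (h has_integral 0) {a..1}"
  shows "AE x in unit_interval. h x = 0"
proof -
  note [measurable] = hb
  define f where "f x = indicat_real {0..1} x *\<^sub>R h x" for x
  have fb[measurable]: "f \<in> borel_measurable borel" unfolding f_def by measurable
  have "integrable lebesgue f"
    using h unfolding f_def by (subst (asm) integrable_restrict_space) auto
  then have f: "integrable lborel f"
    by (simp add: integrable_completion)
  have ray: "set_lebesgue_integral lborel {a..} f = 0" for a :: real
  proof -
    let ?F = "\<lambda>x. indicat_real {a..} x *\<^sub>R f x"
    have "integrable lborel ?F"
      using f by (intro integrable_mult_indicator) auto
    then have "(?F has_integral (LINT x|lborel. ?F x)) UNIV"
      by (rule has_integral_integral_lborel)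
    moreover have "(?F has_integral 0) UNIV"
    proof (cases "a \<le> 1")
      case True
      have eq: "?F = (\<lambda>x. if x \<in> {max a 0..1} then h x else 0)"
        by (auto simp: f_def indicator_def)
      have "(h has_integral 0) {max a 0..1}" using True by (intro zero) auto
      then show ?thesis unfolding eq by (subst has_integral_restrict_UNIV)
    next
      case False
      then have "?F = (\<lambda>x. 0)" by (auto simp: f_def indicator_def)
      then show ?thesis by simp
    qed
    ultimately show ?thesis
      unfolding set_lebesgue_integral_def by (rule has_integral_unique)
  qed
  have all: "set_lebesgue_integral lborel UNIV f = 0"
  proof -
    have "set_lebesgue_integral lborel UNIV f = set_lebesgue_integral lborel {0..} f"
      unfolding set_lebesgue_integral_def by (intro Bochner_Integration.integral_cong) (auto simp: f_def indicator_def)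
    then show ?thesis using ray by simp
  qed
  have sint: "set_integrable lborel A f" if "A \<in> sets borel" for A
    using that f unfolding set_integrable_def by (intro integrable_mult_indicator) auto
  have "set_lebesgue_integral lborel A f = 0" if A: "A \<in> sets lborel" for A
  proof -
    have "Int_stable (range (\<lambda>a::real. {a..}))" "range (\<lambda>a::real. {a..}) \<subseteq> Pow UNIV"
    proof -
      have "{a..} \<inter> {b..} = {max a b..}" for a b :: real by auto
      then show "Int_stable (range (\<lambda>a::real. {a..}))" by (auto simp: Int_stable_def)
    qed auto
    moreover have "A \<in> sigma_sets UNIV (range (\<lambda>a::real. {a..}))"
      using A by (simp add: borel_Ici)
    ultimately show ?thesis
    proof (induction rule: sigma_sets_induct_disjoint)
      case (compl A)
      then have [measurable]: "A \<in> sets borel" by (simp add: borel_Ici)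
      have "set_lebesgue_integral lborel (A \<union> (UNIV - A)) f =
          set_lebesgue_integral lborel A f + set_lebesgue_integral lborel (UNIV - A) f"
        by (intro set_integral_Un sint) auto
      then show ?case using compl.IH all by simp
    next
      case (union A)
      then have A: "A i \<in> sets borel" for i by (auto simp: borel_Ici)
      have "set_lebesgue_integral lborel (\<Union>i. A i) f = (\<Sum>i. set_lebesgue_integral lborel (A i) f)"
        using union.hyps(1) A by (intro lebesgue_integral_countable_add sint) (auto simp: disjoint_family_on_def)
      then show ?case using union.IH by simp
    qed (auto simp: ray, simp add: set_lebesgue_integral_def)
  qed
  from sigma_finite_measure.density_zero[OF sigma_finite_lborel f this] have "AE x in lborel. f x = 0" .
  then have "AE x in lborel. x \<in> {0..1} \<longrightarrow> h x = 0"
    by eventually_elim (auto simp: f_def)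
  then show ?thesis unfolding AE_lebesgue_on_interval_iff by (rule AE_completion)
qed

lemma L2_integrable:
  assumes "L2_periodic w"
  shows "integrable unit_interval w"
proof (rule Bochner_Integration.integrable_bound)
  interpret finite_measure unit_interval
    by (rule finite_measure_lebesgue_on) auto
  show "integrable unit_interval (\<lambda>x. 1 + (norm (w x))\<^sup>2)"
    using assms by (auto simp: L2_periodic_def)
  show "w \<in> borel_measurable unit_interval" using assms by (simp add: L2_periodic_def)
  have "y \<le> 1 + y\<^sup>2" for y :: real
    using zero_le_power2[of "y - 1/2"] by (simp add: power2_eq_square algebra_simps)
  then show "AE x in unit_interval. norm (w x) \<le> norm (1 + (norm (w x))\<^sup>2)"
    by (intro AE_I2) auto
qed

lemma weak_deriv_W12:
  assumes "f \<in> W12"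
  shows "L2_periodic (weak_deriv f)" "has_weak_deriv f (weak_deriv f)"
proof -
  have "\<exists>g. L2_periodic g \<and> has_weak_deriv f g" using assms by (simp add: W12_def)
  from someI_ex[OF this] show "L2_periodic (weak_deriv f)" "has_weak_deriv f (weak_deriv f)"
    by (simp_all add: weak_deriv_def)
qed

section \<open>Local energy and chord length\<close>

definition energy_density :: "(real \<Rightarrow> 'a::euclidean_space) \<Rightarrow> real \<Rightarrow> real \<Rightarrow> ennreal" where
  "energy_density g u v = ennreal ((norm (g u - g v))\<^sup>2 / (periodic_dist u v)\<^sup>2)"

text \<open>
  The inner integral of \<^const>\<open>half_energy\<close>. Reducing the double integral over \<open>I \<times> I\<close> to an integral of this
  function over \<open>I\<close> makes one-dimensional absolute continuity sufficient.
\<close>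

definition energy_potential :: "(real \<Rightarrow> 'a::euclidean_space) \<Rightarrow> real \<Rightarrow> ennreal" where
  "energy_potential g u = (\<integral>\<^sup>+v. energy_density g u v \<partial>unit_interval)"

lemma half_energy_eq: "half_energy g = (\<integral>\<^sup>+u. energy_potential g u \<partial>unit_interval)"
  by (simp add: half_energy_def energy_potential_def energy_density_def)

lemma half_energy_cong_AE:
  assumes ae: "AE x in unit_interval. w x = g x"
  shows "half_energy w = half_energy g"
  unfolding half_energy_eq
proof (rule nn_integral_cong_AE)
  show "AE u in unit_interval. energy_potential w u = energy_potential g u"
    using ae
  proof eventually_elim
    case (elim u)
    show ?case
      unfolding energy_potential_def energy_density_def
      by (intro nn_integral_cong_AE eventually_mono[OF ae]) (simp add: elim)
  qed
qed

lemma infdist_Ints_shift: "infdist (x + of_int n) \<int> = infdist (x::real) \<int>"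
proof -
  have le: "infdist (x + of_int n) \<int> \<le> infdist x \<int>" for x :: real and n
  proof -
    have "infdist (x + of_int n) \<int> \<le> dist x a" if "a \<in> \<int>" for a
      using infdist_le[of "a + of_int n" \<int> "x + of_int n"] that by (simp add: dist_real_def)
    then have "infdist (x + of_int n) \<int> \<le> (INF a\<in>\<int>. dist x a)"
      by (intro cINF_greatest) (auto intro: Ints_0)
    then show ?thesis by (subst (2) infdist_notempty) (auto intro: Ints_0)
  qed
  from le[of x n] le[of "x + of_int n" "- n"] show ?thesis by simp
qed

lemma energy_density_shift:
  assumes "\<And>x n. g (x + of_int n) = g x"
  shows "energy_density g (u + of_int n) v = energy_density g u v"
    "energy_density g u (v + of_int n) = energy_density g u v"
proof -
  have "u + of_int n - v = (u - v) + of_int n" "u - (v + of_int n) = (u - v) + of_int (- n)"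
    by simp_all
  then show "energy_density g (u + of_int n) v = energy_density g u v"
    "energy_density g u (v + of_int n) = energy_density g u v"
    unfolding energy_density_def periodic_dist_def by (simp_all only: assms infdist_Ints_shift)
qed

text \<open>
  The periodic distance of \<open>u\<close> and \<open>v\<close> is at most \<open>|u - v|\<close>. It vanishes only for
  \<open>u = v\<close> in this range, where the division by zero is harmless because the numerator vanishes as well.
\<close>

lemma energy_density_lower:
  assumes "\<bar>u - v\<bar> \<le> r" "r < 1"
  shows "ennreal ((norm (g u - g v))\<^sup>2) \<le> ennreal (r\<^sup>2) * energy_density g u v"
proof (cases "periodic_dist u v = 0")
  case True
  then have "u - v \<in> \<int>"
    unfolding periodic_dist_def using in_closed_iff_infdist_zero[of \<int> "u - v"] closed_Ints
    by (auto intro: Ints_0)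
  then obtain k :: int where "u - v = of_int k" by (auto elim: Ints_cases)
  with assms have "real_of_int \<bar>k\<bar> < 1" by simp
  then have "k = 0" by linarith
  with \<open>u - v = of_int k\<close> have "u = v" by simp
  then show ?thesis by simp
next
  case False
  have pd: "0 < periodic_dist u v"
    using False infdist_nonneg[of "u - v" \<int>] by (simp add: periodic_dist_def)
  have "periodic_dist u v \<le> r"
    using infdist_le[of 0 \<int> "u - v"] assms by (simp add: periodic_dist_def dist_real_def)
  then have "(periodic_dist u v)\<^sup>2 \<le> r\<^sup>2" using pd by (intro power_mono) auto
  then have "(norm (g u - g v))\<^sup>2 * (periodic_dist u v)\<^sup>2 \<le> (norm (g u - g v))\<^sup>2 * r\<^sup>2"
    by (intro mult_left_mono) auto
  then have "(norm (g u - g v))\<^sup>2 \<le> r\<^sup>2 * ((norm (g u - g v))\<^sup>2 / (periodic_dist u v)\<^sup>2)"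
    using pd by (simp add: field_simps)
  then show ?thesis
    unfolding energy_density_def by (simp add: ennreal_mult[symmetric] ennreal_leI)
qed

lemma measurable_energy_density:
  assumes [measurable]: "g \<in> borel_measurable borel"
  shows "(\<lambda>(u, v). energy_density g u v) \<in> borel_measurable (borel \<Otimes>\<^sub>M borel)"
proof -
  have [measurable]: "(\<lambda>x::real. infdist x \<int>) \<in> borel_measurable borel"
    by (intro borel_measurable_continuous_onI continuous_intros)
  show ?thesis unfolding energy_density_def periodic_dist_def by measurable
qed

lemma measurable_energy_potential:
  assumes g: "g \<in> borel_measurable borel"
  shows "energy_potential g \<in> borel_measurable borel"
proof -
  note [measurable] = measurable_energy_density[OF g]
  have "(\<lambda>u. \<integral>\<^sup>+v. energy_density g u v * indicator {0..1} v \<partial>lborel) \<in> borel_measurable borel"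
    by measurable
  then show ?thesis
    unfolding energy_potential_def by (simp add: nn_integral_lebesgue_on)
qed

lemma borel_measurable_lebesgue_on: "f \<in> borel_measurable borel \<Longrightarrow> f \<in> borel_measurable (lebesgue_on A)"
  by (intro measurable_restrict_space1 measurable_completion) simp

lemma measurable_energy_density_slice:
  assumes g: "g \<in> borel_measurable borel"
  shows "energy_density g u \<in> borel_measurable borel"
  using measurable_Pair2[OF measurable_energy_density[OF g], of u] by simp

lemma energy_potential_shift:
  assumes "\<And>x n. g (x + of_int n) = g x"
  shows "energy_potential g (u + of_int n) = energy_potential g u"
  using assms by (simp add: energy_potential_def energy_density_shift)

lemma local_energy_le_potential:
  assumes g: "g \<in> borel_measurable borel" and per: "\<And>x n. g (x + of_int n) = g x"
    and t: "0 \<le> t" "t \<le> 1" and r: "0 < r" "r < 1"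
  shows "(\<integral>\<^sup>+u. \<integral>\<^sup>+v. ennreal ((norm (g u - g v))\<^sup>2) \<partial>lebesgue_on {t..t+r} \<partial>lebesgue_on {t..t+r})
    \<le> ennreal (r\<^sup>2) * (\<integral>\<^sup>+u. energy_potential g u \<partial>lebesgue_on {t..t+r})"
proof -
  note meas = measurable_energy_density_slice[OF g]
  have inner: "(\<integral>\<^sup>+v. ennreal ((norm (g u - g v))\<^sup>2) \<partial>lebesgue_on {t..t+r}) \<le> ennreal (r\<^sup>2) * energy_potential g u"
    if u: "u \<in> {t..t+r}" for u
  proof -
    have "(\<integral>\<^sup>+v. ennreal ((norm (g u - g v))\<^sup>2) \<partial>lebesgue_on {t..t+r})
        \<le> (\<integral>\<^sup>+v. ennreal (r\<^sup>2) * energy_density g u v \<partial>lebesgue_on {t..t+r})"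
      using u r by (intro nn_integral_mono energy_density_lower) auto
    also have "\<dots> = ennreal (r\<^sup>2) * (\<integral>\<^sup>+v. energy_density g u v \<partial>lebesgue_on {t..t+r})"
      by (intro nn_integral_cmult borel_measurable_lebesgue_on meas)
    also have "(\<integral>\<^sup>+v. energy_density g u v \<partial>lebesgue_on {t..t+r})
        \<le> (\<integral>\<^sup>+v. energy_density g u v \<partial>lebesgue_on {t..t+1})"
      using r by (intro nn_integral_lebesgue_on_subset) auto
    also have "\<dots> = energy_potential g u"
      unfolding energy_potential_def
      using energy_density_shift(2)[of g u _ 1, OF per] t by (intro nn_integral_period_shift meas) auto
    finally show ?thesis by (simp add: mult_left_mono)
  qed
  have "(\<integral>\<^sup>+u. \<integral>\<^sup>+v. ennreal ((norm (g u - g v))\<^sup>2) \<partial>lebesgue_on {t..t+r} \<partial>lebesgue_on {t..t+r})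
      \<le> (\<integral>\<^sup>+u. ennreal (r\<^sup>2) * energy_potential g u \<partial>lebesgue_on {t..t+r})"
    using inner by (intro nn_integral_mono) auto
  also have "\<dots> = ennreal (r\<^sup>2) * (\<integral>\<^sup>+u. energy_potential g u \<partial>lebesgue_on {t..t+r})"
    by (intro nn_integral_cmult borel_measurable_lebesgue_on measurable_energy_potential g)
  finally show ?thesis .
qed

lemma potential_integral_shift:
  assumes g: "g \<in> borel_measurable borel" and per: "\<And>x n. g (x + of_int n) = g x"
    and t: "0 \<le> t" "t \<le> 1"
  shows "(\<integral>\<^sup>+u. energy_potential g u \<partial>lebesgue_on {t..t+1}) = half_energy g"
  unfolding half_energy_eq
  using energy_potential_shift[of g _ 1, OF per] t
  by (intro nn_integral_period_shift measurable_energy_potential g) auto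

lemma potential_integral_le:
  assumes "g \<in> borel_measurable borel" "\<And>x n. g (x + of_int n) = g x" "0 \<le> t" "t \<le> 1" "r \<le> 1"
  shows "(\<integral>\<^sup>+u. energy_potential g u \<partial>lebesgue_on {t..t+r}) \<le> half_energy g"
  unfolding potential_integral_shift[OF assms(1-4), symmetric]
  using assms(5) by (intro nn_integral_lebesgue_on_subset) auto

text \<open>
  Absolute continuity of the integral, uniformly in the position of the interval: the primitive of the
  potential is uniformly continuous on \<open>[0, 2]\<close>, which contains all arcs of length at most one that start in the unit interval.
\<close>

lemma potential_absolutely_continuous:
  assumes g: "g \<in> borel_measurable borel" and per: "\<And>x n. g (x + of_int n) = g x"
    and fin: "half_energy g < \<infinity>" and \<delta>: "0 < \<delta>"
  obtains r0 where "0 < r0" "\<And>t r. 0 \<le> t \<Longrightarrow> t \<le> 1 \<Longrightarrow> 0 < r \<Longrightarrow> r \<le> r0 \<Longrightarrow>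
    (\<integral>\<^sup>+u. energy_potential g u \<partial>lebesgue_on {t..t+r}) \<le> ennreal \<delta>"
proof -
  note [measurable] = measurable_energy_potential[OF g]
  define h where "h u = enn2real (energy_potential g u)" for u
  have hb[measurable]: "h \<in> borel_measurable borel" unfolding h_def by measurable
  have "(\<integral>\<^sup>+u. energy_potential g u \<partial>lebesgue_on {0..2}) \<le>
      (\<integral>\<^sup>+u. energy_potential g u \<partial>lebesgue_on {0..0+1}) + (\<integral>\<^sup>+u. energy_potential g u \<partial>lebesgue_on {1..1+1})"
    by (subst (1 2 3) nn_integral_lebesgue_on)
      (auto simp: nn_integral_add[symmetric] indicator_def intro!: nn_integral_mono)
  also have "\<dots> < \<infinity>"
    using fin by (simp only: potential_integral_shift[OF g per] zero_le_one order_refl) simp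
  finally have fin2: "(\<integral>\<^sup>+u. energy_potential g u \<partial>lebesgue_on {0..2}) < \<infinity>" .
  have "AE u in lebesgue_on {0..2}. energy_potential g u \<noteq> \<infinity>"
    using fin2 by (intro nn_integral_PInf_AE borel_measurable_lebesgue_on) auto
  then have ae: "AE u in lebesgue. u \<in> {0..2} \<longrightarrow> energy_potential g u = ennreal (h u)"
    unfolding AE_lebesgue_on_interval_iff by eventually_elim (auto simp: h_def top.not_eq_extremum)
  have hint: "integrable (lebesgue_on {0..2}) h"
  proof (rule integrableI_bounded)
    show "h \<in> borel_measurable (lebesgue_on {0..2})" by (rule borel_measurable_lebesgue_on) simp
    have "(\<integral>\<^sup>+u. ennreal (norm (h u)) \<partial>lebesgue_on {0..2}) = (\<integral>\<^sup>+u. energy_potential g u \<partial>lebesgue_on {0..2})"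
      by (intro nn_integral_cong_AE, unfold AE_lebesgue_on_interval_iff, rule eventually_mono[OF ae]) (simp add: h_def)
    then show "(\<integral>\<^sup>+u. ennreal (norm (h u)) \<partial>lebesgue_on {0..2}) < \<infinity>" using fin2 by simp
  qed
  have hi: "h integrable_on {0..2}"
    using has_integral_integral_lebesgue_on[OF hint] by auto
  define G where "G x = integral {0..x} h" for x
  have "uniformly_continuous_on {0..2} G"
    unfolding G_def by (intro compact_uniformly_continuous indefinite_integral_continuous_1 hi) auto
  then obtain d where d: "0 < d" "\<And>x y. x \<in> {0..2} \<Longrightarrow> y \<in> {0..2} \<Longrightarrow> dist y x < d \<Longrightarrow> dist (G y) (G x) < \<delta>"
    using \<delta> unfolding uniformly_continuous_on_def by blast
  define r0 where "r0 = min 1 (d / 2)"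
  have "(\<integral>\<^sup>+u. energy_potential g u \<partial>lebesgue_on {t..t+r}) \<le> ennreal \<delta>"
    if t: "0 \<le> t" "t \<le> 1" and r: "0 < r" "r \<le> r0" for t r
  proof -
    have r1: "r \<le> 1" "r < d" using r d(1) by (auto simp: r0_def)
    have ih: "integrable (lebesgue_on {t..t+r}) h"
      using hint t r1 by (intro integrable_subinterval[OF hint]) auto
    have "(\<integral>\<^sup>+u. energy_potential g u \<partial>lebesgue_on {t..t+r}) = (\<integral>\<^sup>+u. ennreal (h u) \<partial>lebesgue_on {t..t+r})"
      using t r1
      by (intro nn_integral_cong_AE, unfold AE_lebesgue_on_interval_iff, intro eventually_mono[OF ae]) auto
    also have "\<dots> = ennreal (LINT u|lebesgue_on {t..t+r}. h u)"
    proof -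
      have "0 \<le> h u" for u by (simp add: h_def)
      then show ?thesis using ih by (intro nn_integral_eq_integral) auto
    qed
    also have "(LINT u|lebesgue_on {t..t+r}. h u) = integral {t..t+r} h"
      using ih by (intro lebesgue_integral_eq_integral) auto
    also have "\<dots> = G (t + r) - G t"
    proof -
      have "h integrable_on {0..t+r}"
        using hi t r1 by (auto intro: integrable_subinterval_real)
      from Henstock_Kurzweil_Integration.integral_combine[OF _ _ this, of t]
      show ?thesis using t r by (simp add: G_def)
    qed
    also have "\<dots> \<le> \<delta>"
      using d(2)[of t "t + r"] t r r1 by (auto simp: dist_real_def)
    finally show ?thesis by (simp add: ennreal_leI)
  qed
  then show ?thesis using d(1) by (intro that[of r0]) (auto simp: r0_def)
qed

lemma norm_add_square_le: "(norm (a + b))\<^sup>2 \<le> 2 * (norm a)\<^sup>2 + 2 * (norm (b :: 'a::real_inner))\<^sup>2"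
proof -
  have "(norm (a + b))\<^sup>2 + (norm (a - b))\<^sup>2 = 2 * (norm a)\<^sup>2 + 2 * (norm b)\<^sup>2"
    by (simp add: power2_norm_eq_inner inner_commute algebra_simps)
  then show ?thesis using zero_le_power2[of "norm (a - b)"] by linarith
qed

lemma energy_density_add_le:
  "energy_density (\<lambda>x. a x + b x) u v \<le> 2 * energy_density a u v + 2 * energy_density b u v"
proof -
  let ?q = "(periodic_dist u v)\<^sup>2"
  have "(norm ((a u + b u) - (a v + b v)))\<^sup>2 \<le> 2 * (norm (a u - a v))\<^sup>2 + 2 * (norm (b u - b v))\<^sup>2"
    using norm_add_square_le[of "a u - a v" "b u - b v"] by (simp add: algebra_simps)
  then have "(norm ((a u + b u) - (a v + b v)))\<^sup>2 / ?q \<le> (2 * (norm (a u - a v))\<^sup>2 + 2 * (norm (b u - b v))\<^sup>2) / ?q"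
    by (rule divide_right_mono) simp
  then have "energy_density (\<lambda>x. a x + b x) u v \<le>
      ennreal (2 * ((norm (a u - a v))\<^sup>2 / ?q) + 2 * ((norm (b u - b v))\<^sup>2 / ?q))"
    unfolding energy_density_def by (intro ennreal_leI) (simp add: add_divide_distrib)
  also have "\<dots> = 2 * energy_density a u v + 2 * energy_density b u v"
  proof -
    have *: "ennreal (2 * x + 2 * y) = 2 * ennreal x + 2 * ennreal y" if "0 \<le> x" "0 \<le> y" for x y
      using that by (simp add: ennreal_mult)
    show ?thesis unfolding energy_density_def by (rule *) auto
  qed
  finally show ?thesis .
qed

lemma energy_potential_add_le:
  assumes a: "a \<in> borel_measurable borel" and b: "b \<in> borel_measurable borel"
  shows "energy_potential (\<lambda>x. a x + b x) u \<le> 2 * energy_potential a u + 2 * energy_potential b u"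
proof -
  have [measurable]: "energy_density a u \<in> borel_measurable unit_interval"
    "energy_density b u \<in> borel_measurable unit_interval"
    by (intro borel_measurable_lebesgue_on measurable_energy_density_slice a b)+
  have "energy_potential (\<lambda>x. a x + b x) u \<le> (\<integral>\<^sup>+v. 2 * energy_density a u v + 2 * energy_density b u v \<partial>unit_interval)"
    unfolding energy_potential_def by (intro nn_integral_mono energy_density_add_le)
  then show ?thesis
    by (simp add: nn_integral_add nn_integral_cmult energy_potential_def)
qed

lemma potential_integral_add_le:
  assumes a: "a \<in> borel_measurable borel" and b: "b \<in> borel_measurable borel"
  shows "(\<integral>\<^sup>+u. energy_potential (\<lambda>x. a x + b x) u \<partial>lebesgue_on A) \<le>
    2 * (\<integral>\<^sup>+u. energy_potential a u \<partial>lebesgue_on A) + 2 * (\<integral>\<^sup>+u. energy_potential b u \<partial>lebesgue_on A)"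
proof -
  have [measurable]: "energy_potential a \<in> borel_measurable (lebesgue_on A)"
    "energy_potential b \<in> borel_measurable (lebesgue_on A)"
    by (intro borel_measurable_lebesgue_on measurable_energy_potential a b)+
  have "(\<integral>\<^sup>+u. energy_potential (\<lambda>x. a x + b x) u \<partial>lebesgue_on A) \<le>
    (\<integral>\<^sup>+u. 2 * energy_potential a u + 2 * energy_potential b u \<partial>lebesgue_on A)"
    by (intro nn_integral_mono energy_potential_add_le a b)
  then show ?thesis by (simp add: nn_integral_add nn_integral_cmult)
qed

lemma half_energy_minus: "half_energy (\<lambda>x. - g x) = half_energy g"
  unfolding half_energy_def by (simp add: norm_minus_commute)

text \<open>
  For unit vectors \<open>|g u - g v|\<^sup>2 = 2 - 2 \<langle>g u, g v\<rangle>\<close>, so the double integral equals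
  \<open>2 r\<^sup>2 - 2 |w|\<^sup>2\<close>: the oscillation of the tangent is exactly the defect of the chord.
\<close>

lemma chord_lower_bound:
  fixes g :: "real \<Rightarrow> 'a::euclidean_space"
  assumes g: "g \<in> borel_measurable borel" and unit: "AE u in lebesgue_on {t..t+r}. norm (g u) = 1"
    and w: "(g has_integral w) {t..t+r}" and r: "0 < r" and S: "0 \<le> S"
    and energy: "(\<integral>\<^sup>+u. \<integral>\<^sup>+v. ennreal ((norm (g u - g v))\<^sup>2) \<partial>lebesgue_on {t..t+r} \<partial>lebesgue_on {t..t+r})
      \<le> ennreal (r\<^sup>2) * ennreal S"
  shows "2 * (r\<^sup>2 - (norm w)\<^sup>2) \<le> r\<^sup>2 * S" and "norm w \<le> r"
proof -
  let ?M = "lebesgue_on {t..t+r}"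
  interpret finite_measure ?M by (rule finite_measure_lebesgue_on) auto
  have meas: "measure ?M {t..t+r} = r" using r by (subst measure_restrict_space) auto
  have gint: "integrable ?M g"
  proof (rule Bochner_Integration.integrable_bound)
    show "integrable ?M (\<lambda>u. 1 :: real)" by simp
    show "g \<in> borel_measurable ?M" using g by (rule borel_measurable_lebesgue_on)
    show "AE u in ?M. norm (g u) \<le> norm (1 :: real)" using unit by eventually_elim simp
  qed
  have w': "(LINT u|?M. g u) = w"
    using has_integral_unique[OF has_integral_integral_lebesgue_on[OF gint] w] by simp
  have "norm w \<le> (LINT u|?M. norm (g u))" unfolding w'[symmetric] by (rule integral_norm_bound)
  also have "\<dots> = (LINT u|?M. 1)"
    using unit gint by (intro integral_cong_AE) auto
  also have "\<dots> = r" using meas by simp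
  finally show nw: "norm w \<le> r" .
  have inner: "AE u in ?M. (\<integral>\<^sup>+v. ennreal ((norm (g u - g v))\<^sup>2) \<partial>?M) = ennreal (2 * r - 2 * (g u \<bullet> w))"
    using unit
  proof eventually_elim
    case (elim u)
    have nn: "AE v in ?M. 0 \<le> 2 - 2 * (g u \<bullet> g v)"
      using unit
    proof eventually_elim
      case (elim v)
      then show ?case using norm_cauchy_schwarz[of "g u" "g v"] \<open>norm (g u) = 1\<close> by simp
    qed
    have "(\<integral>\<^sup>+v. ennreal ((norm (g u - g v))\<^sup>2) \<partial>?M) = (\<integral>\<^sup>+v. ennreal (2 - 2 * (g u \<bullet> g v)) \<partial>?M)"
    proof (intro nn_integral_cong_AE eventually_mono[OF unit])
      fix v assume "norm (g v) = 1"
      then have "g v \<bullet> g v = 1" "g u \<bullet> g u = 1" using elim by (simp_all add: norm_eq_1)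
      then have "(norm (g u - g v))\<^sup>2 = 2 - 2 * (g u \<bullet> g v)"
        by (simp add: power2_norm_eq_inner inner_commute algebra_simps)
      then show "ennreal ((norm (g u - g v))\<^sup>2) = ennreal (2 - 2 * (g u \<bullet> g v))" by simp
    qed
    also have "\<dots> = ennreal (LINT v|?M. 2 - 2 * (g u \<bullet> g v))"
      using gint nn by (intro nn_integral_eq_integral) auto
    also have "(LINT v|?M. 2 - 2 * (g u \<bullet> g v)) = 2 * r - 2 * (g u \<bullet> w)"
      using gint by (simp add: meas w')
    finally show ?case .
  qed
  have "AE u in ?M. 0 \<le> 2 * r - 2 * (g u \<bullet> w)"
    using unit
  proof eventually_elim
    case (elim u)
    then show ?case using norm_cauchy_schwarz[of "g u" w] nw by simp
  qed
  then have "(\<integral>\<^sup>+u. ennreal (2 * r - 2 * (g u \<bullet> w)) \<partial>?M) = ennreal (LINT u|?M. 2 * r - 2 * (g u \<bullet> w))"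
    using gint by (intro nn_integral_eq_integral) auto
  also have "(LINT u|?M. 2 * r - 2 * (g u \<bullet> w)) = 2 * r\<^sup>2 - 2 * (norm w)\<^sup>2"
    using gint by (simp add: meas w' dot_square_norm power2_eq_square[of r])
  finally have "ennreal (2 * r\<^sup>2 - 2 * (norm w)\<^sup>2) \<le> ennreal (r\<^sup>2 * S)"
    using energy inner S by (simp add: nn_integral_cong_AE[OF inner] ennreal_mult)
  then show "2 * (r\<^sup>2 - (norm w)\<^sup>2) \<le> r\<^sup>2 * S"
    using S by (simp add: ennreal_le_iff)
qed

lemma periodic_fun_simple'_of_int:
  assumes "periodic_fun_simple' f"
  shows "f (x + of_int n) = f x"
proof -
  interpret periodic_fun_simple' f by fact
  show ?thesis by (rule plus_of_int)
qed

lemma derivative_integral_beyond_period: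
  fixes f g :: "real \<Rightarrow> 'a::euclidean_space"
  assumes fper: "\<And>x n. f (x + of_int n) = f x" and gper: "\<And>x n. g (x + of_int n) = g x"
    and int: "\<And>a b. 0 \<le> a \<Longrightarrow> a \<le> b \<Longrightarrow> b \<le> 1 \<Longrightarrow> (g has_integral (f b - f a)) {a..b}"
    and ab: "0 \<le> a" "a \<le> b" "b \<le> 2"
  shows "(g has_integral (f b - f a)) {a..b}"
proof -
  have up: "(g has_integral (f y - f x)) {x..y}" if "1 \<le> x" "x \<le> y" "y \<le> 2" for x y
  proof -
    have "(g has_integral (f (y - 1) - f (x - 1))) {x - 1..y - 1}"
      using that by (intro int) auto
    from has_integral_shift_real_ivl[OF this, of "- 1"]
    show ?thesis using fper[of "x - 1" 1] fper[of "y - 1" 1] gper[of _ "- 1"] by simp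
  qed
  consider "b \<le> 1" | "1 \<le> a" | "a \<le> 1" "1 \<le> b" by linarith
  then show ?thesis
  proof cases
    case 3
    from has_integral_combine[OF 3 int up] show ?thesis using 3 ab by simp
  qed (use int up ab in auto)
qed

lemma AE_periodic:
  fixes P :: "real \<Rightarrow> bool"
  assumes P[measurable]: "Measurable.pred borel P" and per: "\<And>x. P (x + 1) = P x"
    and ae: "AE x in unit_interval. P x" and t: "0 \<le> t" "t \<le> 1" "r \<le> 1"
  shows "AE x in lebesgue_on {t..t+r}. P x"
proof -
  let ?F = "\<lambda>x. indicator {x. \<not> P x} x :: ennreal"
  have F[measurable]: "?F \<in> borel_measurable borel" by measurable
  have "(\<integral>\<^sup>+x. ?F x \<partial>lebesgue_on {t..t+r}) \<le> (\<integral>\<^sup>+x. ?F x \<partial>lebesgue_on {t..t+1})"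
    using t by (intro nn_integral_lebesgue_on_subset) auto
  also have "\<dots> = (\<integral>\<^sup>+x. ?F x \<partial>unit_interval)"
    using per t by (intro nn_integral_period_shift F) (auto simp: indicator_def)
  also have "\<dots> = (\<integral>\<^sup>+x. 0 \<partial>unit_interval)"
    by (intro nn_integral_cong_AE eventually_mono[OF ae]) auto
  finally have "(\<integral>\<^sup>+x. ?F x \<partial>lebesgue_on {t..t+r}) = 0" by simp
  then have "AE x in lebesgue_on {t..t+r}. ?F x = 0"
    by (subst (asm) nn_integral_0_iff_AE) (auto intro: borel_measurable_lebesgue_on)
  then show ?thesis by eventually_elim (auto simp: indicator_def split: if_splits)
qed

lemma lipschitz_of_local:
  fixes f :: "real \<Rightarrow> 'a::real_normed_vector"
  assumes loc: "\<And>s t. s \<le> t \<Longrightarrow> t - s \<le> 1/2 \<Longrightarrow> norm (f t - f s) \<le> t - s"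
  shows "norm (f t - f s) \<le> \<bar>t - s\<bar>"
proof -
  have "norm (f t - f s) \<le> t - s" if "s \<le> t" "t - s \<le> real n / 2" for n s t
    using that
  proof (induction n arbitrary: t)
    case 0
    then show ?case by simp
  next
    case (Suc n)
    show ?case
    proof (cases "t - s \<le> 1/2")
      case True
      then show ?thesis using loc Suc.prems by simp
    next
      case False
      then have "norm (f (t - 1/2) - f s) \<le> (t - 1/2) - s"
        using Suc.prems by (intro Suc.IH) (auto simp: field_simps)
      moreover have "norm (f t - f (t - 1/2)) \<le> 1/2" using loc[of "t - 1/2" t] by simp
      moreover have "norm (f t - f s) \<le> norm (f t - f (t - 1/2)) + norm (f (t - 1/2) - f s)"
        using norm_triangle_ineq[of "f t - f (t - 1/2)" "f (t - 1/2) - f s"] by simp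
      ultimately show ?thesis by simp
    qed
  qed
  then have le: "norm (f t - f s) \<le> t - s" if "s \<le> t" for s t
    using that real_arch_simple[of "2 * (t - s)"] by (metis pos_le_divide_eq zero_less_numeral mult.commute)
  show ?thesis
    using le[of s t] le[of t s] by (cases "s \<le> t") (auto simp: norm_minus_commute)
qed

text \<open>
  By \<open>chord_lower_bound\<close> an energy of at most \<open>1/200\<close> gives \<open>|f (t + r) - f t|\<^sup>2 \<ge> (1 - 1/400) r\<^sup>2\<close>, and
  \<open>1 - 1/400\<close> exceeds its own square. The Lipschitz bound is the other half of
  \<open>chord_lower_bound\<close>, applied with the total energy.
\<close>

lemma nearly_straight_of_small_energy:
  fixes f g :: "real \<Rightarrow> 'a::euclidean_space"
  assumes fper: "\<And>x n. f (x + of_int n) = f x"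
    and g: "g \<in> borel_measurable borel" and gper: "\<And>x n. g (x + of_int n) = g x"
    and int: "\<And>a b. 0 \<le> a \<Longrightarrow> a \<le> b \<Longrightarrow> b \<le> 1 \<Longrightarrow> (g has_integral (f b - f a)) {a..b}"
    and unit: "AE u in unit_interval. norm (g u) = 1"
    and energy: "\<And>t r. 0 \<le> t \<Longrightarrow> t \<le> 1 \<Longrightarrow> 0 < r \<Longrightarrow> r \<le> 2 * \<rho> \<Longrightarrow>
      (\<integral>\<^sup>+u. energy_potential g u \<partial>lebesgue_on {t..t+r}) \<le> ennreal (1/200)"
    and fin: "half_energy g < \<infinity>"
    and \<rho>: "0 < \<rho>" "\<rho> < 1/2"
  shows "nearly_straight \<rho> f"
proof -
  note int2 = derivative_integral_beyond_period[of f g, OF fper gper int]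
  have unit': "AE u in lebesgue_on {t..t+r}. norm (g u) = 1" if "0 \<le> t" "t \<le> 1" "r \<le> 1" for t r
  proof (rule AE_periodic[OF _ _ unit that])
    show "Measurable.pred borel (\<lambda>u. norm (g u) = 1)" using g by measurable
  qed (use gper[of _ 1] in simp)
  have frac: "f (frac s + l) = f (s + l)" for s l
    using fper[of "frac s + l" "\<lfloor>s\<rfloor>"] by (simp add: frac_def algebra_simps)
  have frac0: "f (frac s) = f s" for s using frac[of s 0] by simp
  have fr: "0 \<le> frac s" "frac s \<le> 1" for s :: real
    using frac_lt_1[of s] by auto
  have chord: "2 * (r\<^sup>2 - (norm (f (t + r) - f t))\<^sup>2) \<le> r\<^sup>2 * S" "norm (f (t + r) - f t) \<le> r"
    if r: "0 < r" "r < 1" and S: "0 \<le> S"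
      "(\<integral>\<^sup>+u. energy_potential g u \<partial>lebesgue_on {frac t..frac t+r}) \<le> ennreal S" for t r S
  proof -
    let ?t = "frac t"
    have w: "(g has_integral (f (?t + r) - f ?t)) {?t..?t+r}"
      using r frac_lt_1[of t] by (intro int2) auto
    have "(\<integral>\<^sup>+u. \<integral>\<^sup>+v. ennreal ((norm (g u - g v))\<^sup>2) \<partial>lebesgue_on {?t..?t+r} \<partial>lebesgue_on {?t..?t+r})
      \<le> ennreal (r\<^sup>2) * (\<integral>\<^sup>+u. energy_potential g u \<partial>lebesgue_on {?t..?t+r})"
      using local_energy_le_potential[OF g gper fr r] .
    also have "\<dots> \<le> ennreal (r\<^sup>2) * ennreal S" using S(2) by (rule mult_left_mono) simp
    finally show "2 * (r\<^sup>2 - (norm (f (t + r) - f t))\<^sup>2) \<le> r\<^sup>2 * S" "norm (f (t + r) - f t) \<le> r"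
      using chord_lower_bound[OF g unit' w r(1) S(1)] fr r by (simp_all add: frac frac0)
  qed
  have lip: "norm (f t - f s) \<le> \<bar>t - s\<bar>" for s t
  proof (rule lipschitz_of_local)
    fix s t :: real assume st: "s \<le> t" "t - s \<le> 1/2"
    show "norm (f t - f s) \<le> t - s"
    proof (cases "s = t")
      case False
      have "(\<integral>\<^sup>+u. energy_potential g u \<partial>lebesgue_on {frac s..frac s+(t - s)}) \<le> ennreal (enn2real (half_energy g))"
        using potential_integral_le[OF g gper fr, of "t - s" s] st fin by simp
      from chord(2)[OF _ _ _ this] show ?thesis using st False by simp
    qed simp
  qed
  have "(1 - 1/400) * r \<le> norm (f (t + r) - f t)" if r: "0 < r" "r \<le> 2 * \<rho>" for t r
  proof (rule power2_le_imp_le)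
    have "2 * (r\<^sup>2 - (norm (f (t + r) - f t))\<^sup>2) \<le> r\<^sup>2 * (1/200)"
      using r \<rho> energy[OF fr r] by (intro chord(1)) auto
    then have "399/400 * r\<^sup>2 \<le> (norm (f (t + r) - f t))\<^sup>2" by (simp add: field_simps)
    moreover have "((1 - 1/400) * r)\<^sup>2 \<le> 399/400 * r\<^sup>2"
    proof -
      have "(399/400 :: real)\<^sup>2 \<le> 399/400" by (simp add: power2_eq_square)
      then have "(399/400)\<^sup>2 * r\<^sup>2 \<le> 399/400 * r\<^sup>2" by (rule mult_right_mono) simp
      then show ?thesis by (simp add: power2_eq_square)
    qed
    ultimately show "((1 - 1/400) * r)\<^sup>2 \<le> (norm (f (t + r) - f t))\<^sup>2"
      by (rule order_trans[rotated])
  qed simp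
  with fper lip show ?thesis by (simp add: nearly_straight_def)
qed

section \<open>Stability of knots\<close>

text \<open>
  The Sobolev embedding into bounded functions: \<open>|f|\<close> is below \<open>\<epsilon>\<close> somewhere because its mean square is below
  \<open>\<epsilon>\<^sup>2\<close>, and \<open>f\<close> varies by at most \<open>\<integral>|g| \<le> \<epsilon>\<close>, a consequence of the pointwise inequality
  \<open>|g| \<le> \<epsilon>/2 + |g|\<^sup>2 / (2 \<epsilon>)\<close>.
\<close>

lemma sup_norm_le_W12:
  fixes f g :: "real \<Rightarrow> 'a::euclidean_space"
  assumes f: "continuous_on UNIV f" and g: "integrable unit_interval g"
    and g2: "integrable unit_interval (\<lambda>x. (norm (g x))\<^sup>2)"
    and int: "\<And>a b. 0 \<le> a \<Longrightarrow> a \<le> b \<Longrightarrow> b \<le> 1 \<Longrightarrow> (g has_integral (f b - f a)) {a..b}"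
    and \<epsilon>: "0 < \<epsilon>" and f2: "(LINT x|unit_interval. (norm (f x))\<^sup>2) < \<epsilon>\<^sup>2"
    and g2b: "(LINT x|unit_interval. (norm (g x))\<^sup>2) < \<epsilon>\<^sup>2" and t: "t \<in> {0..1}"
  shows "norm (f t) \<le> 2 * \<epsilon>"
proof -
  interpret finite_measure unit_interval
    by (rule finite_measure_lebesgue_on) auto
  have meas: "measure unit_interval {0..1} = 1"
    by (subst measure_restrict_space) auto
  have "\<exists>s\<in>{0..1}. norm (f s) < \<epsilon>"
  proof (rule ccontr)
    assume "\<not> ?thesis"
    then have "\<epsilon>\<^sup>2 \<le> (norm (f s))\<^sup>2" if "s \<in> {0..1}" for s
      using that \<epsilon> by (intro power_mono) (auto simp: not_less)
    then have "(LINT x|unit_interval. \<epsilon>\<^sup>2) \<le> (LINT x|unit_interval. (norm (f x))\<^sup>2)"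
      using f by (intro integral_mono continuous_imp_integrable_real continuous_intros)
        (auto intro: continuous_on_subset)
    then show False using f2 meas by simp
  qed
  then obtain s where s: "s \<in> {0..1}" "norm (f s) < \<epsilon>" by blast
  have "(LINT x|unit_interval. norm (g x)) \<le> (LINT x|unit_interval. \<epsilon> / 2 + (norm (g x))\<^sup>2 / (2 * \<epsilon>))"
  proof (rule integral_mono)
    fix x
    have "0 \<le> (norm (g x) - \<epsilon>)\<^sup>2" by simp
    then show "norm (g x) \<le> \<epsilon> / 2 + (norm (g x))\<^sup>2 / (2 * \<epsilon>)"
      using \<epsilon> by (simp add: power2_eq_square field_simps)
  qed (use g g2 in auto)
  also have "\<dots> = \<epsilon> / 2 + (LINT x|unit_interval. (norm (g x))\<^sup>2) / (2 * \<epsilon>)"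
    using g2 meas by simp
  also have "\<dots> \<le> \<epsilon>"
    using g2b \<epsilon> by (simp add: power2_eq_square field_simps)
  finally have g1: "(LINT x|unit_interval. norm (g x)) \<le> \<epsilon>" .
  have diff: "norm (f b - f a) \<le> \<epsilon>" if ab: "0 \<le> a" "a \<le> b" "b \<le> 1" for a b
  proof -
    have gs: "integrable (lebesgue_on {a..b}) g"
      using g ab by (intro integrable_subinterval[OF g]) auto
    have "f b - f a = (LINT x|lebesgue_on {a..b}. g x)"
      using has_integral_unique[OF int[OF ab] has_integral_integral_lebesgue_on[OF gs]] by simp
    also have "norm \<dots> \<le> (LINT x|lebesgue_on {a..b}. norm (g x))" by (rule integral_norm_bound)
    also have "\<dots> \<le> (LINT x|unit_interval. norm (g x))"
      using ab g gs by (intro integral_mono_lebesgue_on_AE) auto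
    finally show ?thesis using g1 by simp
  qed
  have "norm (f t - f s) \<le> \<epsilon>"
    using diff[of s t] diff[of t s] s(1) t by (cases "s \<le> t") (auto simp: norm_minus_commute)
  then show ?thesis using s(2) norm_triangle_sub[of "f t" "f s"] by simp
qed

lemma integrable_continuous_scaleR:
  fixes w :: "real \<Rightarrow> 'a::euclidean_space"
  assumes \<phi>: "continuous_on {0..1} \<phi>" and w: "integrable unit_interval w"
  shows "integrable unit_interval (\<lambda>x. \<phi> x *\<^sub>R w x)"
proof -
  have "compact (\<phi> ` {0..1})" using \<phi> by (intro compact_continuous_image) auto
  then obtain M where M: "\<forall>y\<in>\<phi> ` {0..1}. norm y \<le> M"
    using compact_imp_bounded bounded_iff by blast
  show ?thesis
  proof (rule Bochner_Integration.integrable_bound)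
    show "integrable unit_interval (\<lambda>x. M * norm (w x))" using w by auto
    show "(\<lambda>x. \<phi> x *\<^sub>R w x) \<in> borel_measurable unit_interval"
      by (rule borel_measurable_scaleR[OF measurable_unit_interval_continuous[OF \<phi>]
            borel_measurable_integrable[OF w]])
    have "\<bar>\<phi> x\<bar> * norm (w x) \<le> M * norm (w x)" if "x \<in> {0..1}" for x
      using M that by (intro mult_right_mono) auto
    then show "AE x in unit_interval. norm (\<phi> x *\<^sub>R w x) \<le> norm (M * norm (w x))"
      by (intro AE_I2) (simp, meson abs_ge_self order_trans)
  qed
qed

lemma smooth_periodic_continuous:
  assumes "smooth_periodic \<phi>"
  shows "continuous_on A \<phi>" "continuous_on A (deriv \<phi>)"
proof -
  have "(deriv ^^ 0) \<phi> field_differentiable at x" "(deriv ^^ 1) \<phi> field_differentiable at x" for x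
    using assms unfolding smooth_periodic_def by blast+
  then show "continuous_on A \<phi>" "continuous_on A (deriv \<phi>)"
    by (auto intro!: continuous_at_imp_continuous_on field_differentiable_imp_continuous_at)
qed

lemma has_weak_deriv_diff:
  fixes f1 f2 g1 g2 :: "real \<Rightarrow> 'a::euclidean_space"
  assumes "has_weak_deriv f1 g1" "has_weak_deriv f2 g2"
    and int: "integrable unit_interval f1" "integrable unit_interval f2"
      "integrable unit_interval g1" "integrable unit_interval g2"
  shows "has_weak_deriv (\<lambda>x. f1 x - f2 x) (\<lambda>x. g1 x - g2 x)"
  unfolding has_weak_deriv_def
proof (intro allI impI)
  fix \<phi> assume \<phi>: "smooth_periodic \<phi>"
  note c = smooth_periodic_continuous[OF \<phi>]
  have "(LINT x|unit_interval. deriv \<phi> x *\<^sub>R (f1 x - f2 x)) =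
      (LINT x|unit_interval. deriv \<phi> x *\<^sub>R f1 x) - (LINT x|unit_interval. deriv \<phi> x *\<^sub>R f2 x)"
    unfolding scaleR_diff_right
    by (intro Bochner_Integration.integral_diff integrable_continuous_scaleR c int)
  also have "\<dots> = - ((LINT x|unit_interval. \<phi> x *\<^sub>R g1 x) - (LINT x|unit_interval. \<phi> x *\<^sub>R g2 x))"
    using assms(1,2) \<phi> unfolding has_weak_deriv_def by simp
  also have "(LINT x|unit_interval. \<phi> x *\<^sub>R g1 x) - (LINT x|unit_interval. \<phi> x *\<^sub>R g2 x)
      = (LINT x|unit_interval. \<phi> x *\<^sub>R (g1 x - g2 x))"
    unfolding scaleR_diff_right
    by (intro Bochner_Integration.integral_diff[symmetric] integrable_continuous_scaleR c int)
  finally show "(LINT x|unit_interval. deriv \<phi> x *\<^sub>R (f1 x - f2 x)) =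
      - (LINT x|unit_interval. \<phi> x *\<^sub>R (g1 x - g2 x))" .
qed

lemma L2_periodic_diff:
  assumes a: "L2_periodic a" and b: "L2_periodic b"
  shows "L2_periodic (\<lambda>x. a x - b x)"
  unfolding L2_periodic_def
proof (intro conjI)
  have m: "a \<in> borel_measurable unit_interval" "b \<in> borel_measurable unit_interval"
    using a b by (simp_all add: L2_periodic_def)
  then show md: "(\<lambda>x. a x - b x) \<in> borel_measurable unit_interval" by (rule borel_measurable_diff)
  show "periodic_fun_simple' (\<lambda>x. a x - b x)"
    using a b by (simp add: L2_periodic_def periodic_fun_simple'_def)
  show "integrable unit_interval (\<lambda>x. (norm (a x - b x))\<^sup>2)"
  proof (rule Bochner_Integration.integrable_bound)
    show "integrable unit_interval (\<lambda>x. 2 * (norm (a x))\<^sup>2 + 2 * (norm (b x))\<^sup>2)"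
      using a b by (auto simp: L2_periodic_def)
    show "(\<lambda>x. (norm (a x - b x))\<^sup>2) \<in> borel_measurable unit_interval"
      using md by measurable
    show "AE x in unit_interval. norm ((norm (a x - b x))\<^sup>2) \<le> norm (2 * (norm (a x))\<^sup>2 + 2 * (norm (b x))\<^sup>2)"
      using norm_add_square_le[of "a _" "- b _"] by (intro AE_I2) simp
  qed
qed

lemma W12_diff:
  assumes "f \<in> W12" "h \<in> W12"
  shows "(\<lambda>x. f x - h x) \<in> W12"
proof -
  have L2: "L2_periodic f" "L2_periodic h" using assms by (simp_all add: W12_def)
  note wd = weak_deriv_W12[OF assms(1)] weak_deriv_W12[OF assms(2)]
  have "has_weak_deriv (\<lambda>x. f x - h x) (\<lambda>x. weak_deriv f x - weak_deriv h x)"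
    by (intro has_weak_deriv_diff wd L2_integrable L2)
  then show ?thesis
    unfolding W12_def using L2_periodic_diff[OF L2] L2_periodic_diff[OF wd(1,3)] by blast
qed

text \<open>
  All the quantities attached to the weak derivative survive the passage to a representative that agrees with it
  almost everywhere.
\<close>

lemma borel_version_weak_deriv:
  fixes f :: "real \<Rightarrow> 'a::euclidean_space"
  assumes f: "f \<in> W12" and cont: "continuous_on UNIV f" and g: "borel_version (weak_deriv f) g"
  shows "integrable unit_interval g" "integrable unit_interval (\<lambda>x. (norm (g x))\<^sup>2)"
    "(LINT x|unit_interval. (norm (g x))\<^sup>2) = (LINT x|unit_interval. (norm (weak_deriv f x))\<^sup>2)"
    "half_energy g = half_energy (weak_deriv f)"
    "0 \<le> a \<Longrightarrow> a \<le> b \<Longrightarrow> b \<le> 1 \<Longrightarrow> (g has_integral (f b - f a)) {a..b}"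
proof -
  note wd = weak_deriv_W12[OF f]
  have gm: "g \<in> borel_measurable unit_interval" and ae: "AE x in unit_interval. weak_deriv f x = g x"
    using g by (auto simp: borel_version_def intro: borel_measurable_lebesgue_on)
  have wm: "weak_deriv f \<in> borel_measurable unit_interval" using wd by (simp add: L2_periodic_def)
  show gi: "integrable unit_interval g"
    using L2_integrable[OF wd(1)] ae gm wm by (subst integrable_cong_AE[of g _ "weak_deriv f"]) auto
  have sq: "AE x in unit_interval. (norm (g x))\<^sup>2 = (norm (weak_deriv f x))\<^sup>2"
    using ae by eventually_elim simp
  show "integrable unit_interval (\<lambda>x. (norm (g x))\<^sup>2)"
    using wd(1) sq gm wm
    by (subst integrable_cong_AE[of _ _ "\<lambda>x. (norm (weak_deriv f x))\<^sup>2"]) (auto simp: L2_periodic_def)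
  show "(LINT x|unit_interval. (norm (g x))\<^sup>2) = (LINT x|unit_interval. (norm (weak_deriv f x))\<^sup>2)"
    using sq gm wm by (intro integral_cong_AE) auto
  show "half_energy g = half_energy (weak_deriv f)"
    by (rule half_energy_cong_AE[OF ae, symmetric])
  have "has_weak_deriv f g"
    unfolding has_weak_deriv_def
  proof (intro allI impI)
    fix \<phi> assume \<phi>: "smooth_periodic \<phi>"
    have p: "\<phi> \<in> borel_measurable unit_interval"
      by (intro measurable_unit_interval_continuous smooth_periodic_continuous \<phi>)
    have "(LINT x|unit_interval. \<phi> x *\<^sub>R weak_deriv f x) = (LINT x|unit_interval. \<phi> x *\<^sub>R g x)"
      using ae by (intro integral_cong_AE borel_measurable_scaleR p gm wm) (auto elim: eventually_mono)
    then show "(LINT x|unit_interval. deriv \<phi> x *\<^sub>R f x) = - (LINT x|unit_interval. \<phi> x *\<^sub>R g x)"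
      using wd(2)[unfolded has_weak_deriv_def, rule_format, OF \<phi>] by simp
  qed
  then show "(g has_integral (f b - f a)) {a..b}" if "0 \<le> a" "a \<le> b" "b \<le> 1"
    using weak_deriv_has_integral[OF cont gi _ that] by simp
qed

theorem corollary1p5:
  fixes \<gamma> :: "real \<Rightarrow> real^3"
  assumes "knot \<gamma>" and "\<gamma> \<in> W32" and "arclength_parametrized \<gamma>"
  shows "\<exists>\<epsilon>>0. \<forall>\<eta> :: real \<Rightarrow> real^3.
           closed_curve \<eta> \<and> \<eta> \<in> W32 \<and> arclength_parametrized \<eta>
             \<and> W32_norm (\<lambda>u. \<eta> u - \<gamma> u) < \<epsilon>
           \<longrightarrow> knot \<eta> \<and> knot_equivalent \<eta> \<gamma>"
proof -
  have per: "c (x + of_int n) = c x" and cont: "continuous_on UNIV c"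
    if "closed_curve c" for c :: "real \<Rightarrow> real^3" and x n
    using that periodic_fun_simple'_of_int[of c x n] by (simp_all add: closed_curve_def)
  have version: "\<exists>g. borel_version (weak_deriv f) g" if "f \<in> W12" for f :: "real \<Rightarrow> real^3"
    using weak_deriv_W12(1)[OF that] by (intro borel_version_exists) (simp add: L2_periodic_def)
  have \<gamma>: "closed_curve \<gamma>" "inj_on \<gamma> {0..<1}" using assms(1) by (simp_all add: knot_def)
  have \<gamma>W: "\<gamma> \<in> W12" "half_energy (weak_deriv \<gamma>) < \<infinity>" using assms(2) by (simp_all add: W32_def)
  obtain p where p: "borel_version (weak_deriv \<gamma>) p" using version[OF \<gamma>W(1)] by blast
  have pb: "p \<in> borel_measurable borel" and pper: "\<And>x n. p (x + of_int n) = p x"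
    and pae: "AE x in unit_interval. weak_deriv \<gamma> x = p x"
    using p by (simp_all add: borel_version_def)
  note pD = borel_version_weak_deriv[OF \<gamma>W(1) cont[OF \<gamma>(1)] p]
  have pfin: "half_energy p < \<infinity>" using pD(4) \<gamma>W(2) by simp
  obtain r0 where r0: "0 < r0" "\<And>t r. 0 \<le> t \<Longrightarrow> t \<le> 1 \<Longrightarrow> 0 < r \<Longrightarrow> r \<le> r0 \<Longrightarrow>
      (\<integral>\<^sup>+u. energy_potential p u \<partial>lebesgue_on {t..t+r}) \<le> ennreal (1/800)"
    by (rule potential_absolutely_continuous[OF pb pper pfin, of "1/800"]) auto
  define \<rho> where "\<rho> = min (r0 / 2) (1/4)"
  have \<rho>: "0 < \<rho>" "\<rho> < 1/2" "2 * \<rho> \<le> r0" "\<rho> \<le> 1/4" using r0(1) by (auto simp: \<rho>_def)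
  obtain m where m: "0 < m" "separated \<rho> m \<gamma>"
    by (rule separated_of_inj[OF per[OF \<gamma>(1)] cont[OF \<gamma>(1)] \<gamma>(2) \<rho>(1)])
  \<comment> \<open>The averaging scale is chosen after the separation \<open>m\<close>, which depends on \<open>\<rho>\<close>.\<close>
  define r where "r = min \<rho> (m / 100)"
  have r: "0 < r" "r \<le> \<rho>" "100 * r \<le> m" using \<rho> m by (auto simp: r_def)
  have straight\<gamma>: "nearly_straight \<rho> \<gamma>"
  proof (rule nearly_straight_of_small_energy[OF per[OF \<gamma>(1)] pb pper pD(5) _ _ pfin \<rho>(1,2)])
    show "AE u in unit_interval. norm (p u) = 1"
      using assms(3) pae unfolding arclength_parametrized_def by eventually_elim simp
    show "(\<integral>\<^sup>+u. energy_potential p u \<partial>lebesgue_on {t..t+r}) \<le> ennreal (1/200)"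
      if "0 \<le> t" "t \<le> 1" "0 < r" "r \<le> 2 * \<rho>" for t r
      using r0(2)[of t r] that \<rho>(3) by (intro order_trans[OF _ ennreal_leI[of "1/800" "1/200"]]) auto
  qed
  have "knot \<eta> \<and> knot_equivalent \<eta> \<gamma>"
    if \<eta>: "closed_curve \<eta>" "\<eta> \<in> W32" "arclength_parametrized \<eta>"
      and close: "W32_norm (\<lambda>u. \<eta> u - \<gamma> u) < r / 50" for \<eta>
  proof -
    define d where "d u = \<eta> u - \<gamma> u" for u
    have \<eta>W: "\<eta> \<in> W12" "half_energy (weak_deriv \<eta>) < \<infinity>" using \<eta>(2) by (simp_all add: W32_def)
    have dW: "d \<in> W12" using W12_diff[OF \<eta>W(1) \<gamma>W(1)] by (simp add: d_def[abs_def])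
    have dcont: "continuous_on UNIV d"
      unfolding d_def by (intro continuous_intros cont \<eta>(1) \<gamma>(1))
    obtain e where e: "borel_version (weak_deriv \<eta>) e" using version[OF \<eta>W(1)] by blast
    obtain q where q: "borel_version (weak_deriv d) q" using version[OF dW] by blast
    have eb: "e \<in> borel_measurable borel" and eae: "AE x in unit_interval. weak_deriv \<eta> x = e x"
      using e by (simp_all add: borel_version_def)
    have qb: "q \<in> borel_measurable borel" and qper: "\<And>x n. q (x + of_int n) = q x"
      using q by (simp_all add: borel_version_def)
    note eD = borel_version_weak_deriv[OF \<eta>W(1) cont[OF \<eta>(1)] e]
    note qD = borel_version_weak_deriv[OF dW dcont q]
    have split_int: "((\<lambda>x. p x + q x) has_integral (\<eta> b - \<eta> a)) {a..b}"
      if "0 \<le> a" "a \<le> b" "b \<le> 1" for a b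
      using has_integral_add[OF pD(5)[OF that] qD(5)[OF that]] by (simp add: d_def)
    \<comment> \<open>Uniqueness of weak derivatives: the arbitrarily chosen representatives are additive almost everywhere.\<close>
    have "AE x in unit_interval. e x - (p x + q x) = 0"
    proof (rule AE_zero_of_interval_integrals)
      show "integrable unit_interval (\<lambda>x. e x - (p x + q x))" using eD(1) pD(1) qD(1) by auto
      show "(\<lambda>x. e x - (p x + q x)) \<in> borel_measurable borel" using eb pb qb by measurable
      show "((\<lambda>x. e x - (p x + q x)) has_integral 0) {a..1}" if "0 \<le> a" "a \<le> 1" for a
        using has_integral_diff[OF eD(5)[OF that order_refl] split_int[OF that order_refl]] by simp
    qed
    then have epq: "AE x in unit_interval. e x = p x + q x" by eventually_elim simp
    have unit: "AE x in unit_interval. norm (p x + q x) = 1"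
      using \<eta>(3) eae epq unfolding arclength_parametrized_def by eventually_elim simp
    \<comment> \<open>The norm converts the energy by \<^const>\<open>enn2real\<close>, which would hide an infinite value.\<close>
    have qfin: "half_energy q < \<infinity>"
    proof -
      have "half_energy q = half_energy (\<lambda>x. e x + - p x)"
        using epq by (intro half_energy_cong_AE) (auto elim: eventually_mono)
      also have "\<dots> \<le> 2 * half_energy e + 2 * half_energy (\<lambda>x. - p x)"
        unfolding half_energy_eq using eb pb by (intro potential_integral_add_le) auto
      also have "\<dots> < \<infinity>"
        using pfin eD(4) \<eta>W(2) by (simp add: half_energy_minus ennreal_mult_less_top)
      finally show ?thesis .
    qed
    let ?\<epsilon> = "r / 50"
    let ?A = "LINT x|unit_interval. (norm (d x))\<^sup>2" and ?B = "LINT x|unit_interval. (norm (weak_deriv d x))\<^sup>2"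
    have AB: "0 \<le> ?A" "0 \<le> ?B" by simp_all
    have norms: "sqrt (?A + ?B) + sqrt (enn2real (half_energy q)) < ?\<epsilon>"
      using close by (simp add: W32_norm_def W12_norm_def qD(4) d_def[abs_def])
    have "sqrt (?A + ?B) < ?\<epsilon>" using norms real_sqrt_ge_zero[OF enn2real_nonneg[of "half_energy q"]] by linarith
    then have "?A + ?B < ?\<epsilon>\<^sup>2" using real_less_rsqrt r(1) AB
      by (metis real_sqrt_less_iff real_sqrt_unique divide_nonneg_nonneg less_imp_le zero_le_numeral)
    then have "?A < ?\<epsilon>\<^sup>2" "?B < ?\<epsilon>\<^sup>2" using AB by linarith+
    then have d01: "norm (d t) \<le> 2 * ?\<epsilon>" if "t \<in> {0..1}" for t
      using r(1) qD(3) by (intro sup_norm_le_W12[OF dcont qD(1,2,5) _ _ _ that]) auto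
    have dsup: "norm (\<eta> t - \<gamma> t) \<le> r / 25" for t
    proof -
      have "d (frac t) = d t"
        using per[OF \<eta>(1), of "frac t" "\<lfloor>t\<rfloor>"] per[OF \<gamma>(1), of "frac t" "\<lfloor>t\<rfloor>"]
        by (simp add: d_def frac_def)
      then show ?thesis using d01[of "frac t"] frac_lt_1[of t] by (simp add: d_def)
    qed
    have qsmall: "half_energy q \<le> ennreal (1/800)"
    proof -
      have "sqrt (enn2real (half_energy q)) < ?\<epsilon>" using norms real_sqrt_ge_zero[of "?A + ?B"] AB by linarith
      also have "?\<epsilon> \<le> sqrt (1/800)"
        using r \<rho> by (intro real_le_rsqrt order_trans[OF power_mono[of "r/50" "1/200" 2]]) (auto simp: power2_eq_square)
      finally have "enn2real (half_energy q) \<le> 1/800" by simp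
      then have "ennreal (enn2real (half_energy q)) \<le> ennreal (1/800)" by (rule ennreal_leI)
      then show ?thesis by (subst (asm) ennreal_enn2real) (use qfin in auto)
    qed
    have straight\<eta>: "nearly_straight \<rho> \<eta>"
    proof (rule nearly_straight_of_small_energy[OF per[OF \<eta>(1)] _ _ split_int unit _ _ \<rho>(1,2)])
      show "(\<lambda>x. p x + q x) \<in> borel_measurable borel" using pb qb by measurable
      show "p (x + of_int n) + q (x + of_int n) = p x + q x" for x n by (simp add: pper qper)
      have "half_energy (\<lambda>x. p x + q x) \<le> 2 * half_energy p + 2 * half_energy q"
        unfolding half_energy_eq using pb qb by (rule potential_integral_add_le)
      also have "\<dots> < \<infinity>" using pfin qfin by (simp add: ennreal_mult_less_top)
      finally show "half_energy (\<lambda>x. p x + q x) < \<infinity>" .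
      show "(\<integral>\<^sup>+u. energy_potential (\<lambda>x. p x + q x) u \<partial>lebesgue_on {t..t+l}) \<le> ennreal (1/200)"
        if t: "0 \<le> t" "t \<le> 1" "0 < l" "l \<le> 2 * \<rho>" for t l
      proof -
        have "(\<integral>\<^sup>+u. energy_potential (\<lambda>x. p x + q x) u \<partial>lebesgue_on {t..t+l}) \<le>
          2 * (\<integral>\<^sup>+u. energy_potential p u \<partial>lebesgue_on {t..t+l}) +
          2 * (\<integral>\<^sup>+u. energy_potential q u \<partial>lebesgue_on {t..t+l})"
          using pb qb by (rule potential_integral_add_le)
        also have "\<dots> \<le> 2 * ennreal (1/800) + 2 * ennreal (1/800)"
          using t \<rho> order_trans[OF potential_integral_le[OF qb qper, of t l] qsmall]
          by (intro add_mono mult_left_mono r0(2)) auto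
        also have "\<dots> = ennreal (2 * (1/800)) + ennreal (2 * (1/800))"
          by (subst (1 2) ennreal_mult) simp_all
        also have "\<dots> = ennreal (1/200)" by (subst ennreal_plus[symmetric]) auto
        finally show ?thesis .
      qed
    qed
    have "inj_on \<eta> {0..<1}"
      by (rule inj_on_of_nearly_straight_separated[OF straight\<eta> \<rho>(1)
            separated_of_close[OF m(2) dsup]]) (use r in simp)
    then have "knot \<eta>" using \<eta>(1) by (simp add: knot_def)
    moreover
    from homeomorphism_of_nearly_straight_curves[OF straight\<gamma> straight\<eta> m(2) r dsup]
    obtain h k where hk: "homeomorphism UNIV UNIV h k" "\<forall>t. h (\<eta> t) = \<gamma> t" by blast
    have "h ` range \<eta> = range \<gamma>" by (simp add: image_image hk(2))
    with hk(1) have "knot_equivalent \<eta> \<gamma>" unfolding knot_equivalent_def by blast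
    ultimately show ?thesis by blast
  qed
  moreover have "0 < r / 50" using r by simp
  ultimately show ?thesis by blast
qed

end
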